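(* There is an absolute constant $k$ such that for every $N,M\ge 1$ and every partial function $f:[M]^N\to\{0,1,\ast\}$ that is permutation-invariant, we have \[ \operatorname{R}(f)=O\!\left(\operatorname{Q}(f)^{9}\,\log^{k}\operatorname{Q}(f)\right), \] i.e. $\operatorname{R}(f)=O(\operatorname{Q}(f)^9\operatorname{polylog}\operatorname{Q}(f))$, where the implied constants are independent of $N$, $M$ and $f$. In particular $\operatorname{R}(f)\le \operatorname{Q}(f)^{O(1)}$ for all such $f$.
   Context: A partial function $f:[M]^N\to\{0,1,\ast\}$ is defined on the set $S=\{X: f(X)\neq\ast\}$ of inputs $X=(x_1,\dots,x_N)\in[M]^N$. An algorithm accesses $X$ only through queries: given $i\in[N]$ it learns $x_i$ (in the quantum case, by the standard unitary query oracle $|i,z\rangle\mapsto|i,z+x_i \bmod M\rangle$). $\operatorname{R}(f)$ is the (bounded-error) randomized query complexity: the expected number of queries made by an optimal randomized algorithm that, for every $X\in S$, outputs $f(X)$ with probability at least $2/3$. $\operatorname{Q}(f)$ is the bounded-error quantum query complexity: the minimum number of queries of a quantum algorithm that outputs $f(X)$ with probability at least $2/3$ for every $X\in S$. $f$ is permutation-invariant if $f(x_1,\dots,x_N)=f(\tau(x_{\sigma(1)}),\dots,\tau(x_{\sigma(N)}))$ for all $X\in[M]^N$, all $\sigma\in S_N$ and all $\tau\in S_M$. *)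

theory Defs
  imports "HOL-Probability.Probability" "HOL-Combinatorics.Permutations"
begin

text \<open>[M] is rendered 0-based as {0..<M}; an input X in [M]^N is a list of length N
  with entries < M. A partial function f : [M]^N -> {0,1,*} is a map
  nat list => bool option (None = *); only its values on [M]^N matter.\<close>

definition inputs :: "nat \<Rightarrow> nat \<Rightarrow> nat list set" where
  "inputs N M = {X. length X = N \<and> set X \<subseteq> {..<M}}"

definition domset :: "nat \<Rightarrow> nat \<Rightarrow> (nat list \<Rightarrow> bool option) \<Rightarrow> nat list set" where
  "domset N M f = {X \<in> inputs N M. f X \<noteq> None}"

definition perm_invariant :: "nat \<Rightarrow> nat \<Rightarrow> (nat list \<Rightarrow> bool option) \<Rightarrow> bool" where
  "perm_invariant N M f \<longleftrightarrow>
     (\<forall>X \<in> inputs N M. \<forall>\<sigma> \<tau>. \<sigma> permutes {..<N} \<longrightarrow> \<tau> permutes {..<M} \<longrightarrow>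
        f X = f (map (\<lambda>i. \<tau> (X ! \<sigma> i)) [0..<N]))"

definition lookup :: "nat list \<Rightarrow> nat \<Rightarrow> nat" where
  "lookup X i = (if i < length X then X ! i else 0)"

datatype dtree = Leaf bool | Query nat "nat \<Rightarrow> dtree"

primrec dt_eval :: "dtree \<Rightarrow> nat list \<Rightarrow> bool" where
  "dt_eval (Leaf b) X = b"
| "dt_eval (Query i g) X = dt_eval (g (lookup X i)) X"

primrec dt_cost :: "dtree \<Rightarrow> nat list \<Rightarrow> nat" where
  "dt_cost (Leaf b) X = 0"
| "dt_cost (Query i g) X = Suc (dt_cost (g (lookup X i)) X)"

definition rand_correct :: "nat \<Rightarrow> nat \<Rightarrow> (nat list \<Rightarrow> bool option) \<Rightarrow> dtree pmf \<Rightarrow> bool" where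
  "rand_correct N M f A \<longleftrightarrow>
     (\<forall>X \<in> domset N M f. measure_pmf.prob A {T. dt_eval T X = the (f X)} \<ge> 2/3)"

definition rand_cost :: "nat \<Rightarrow> nat \<Rightarrow> (nat list \<Rightarrow> bool option) \<Rightarrow> dtree pmf \<Rightarrow> ennreal" where
  "rand_cost N M f A = (SUP X \<in> domset N M f. \<integral>\<^sup>+ T. ennreal (real (dt_cost T X)) \<partial>(measure_pmf A))"

definition R_cplx :: "nat \<Rightarrow> nat \<Rightarrow> (nat list \<Rightarrow> bool option) \<Rightarrow> ennreal" where
  "R_cplx N M f = (INF A \<in> {A. rand_correct N M f A}. rand_cost N M f A)"

text \<open>State space C^N (x) C^M (x) C^W (workspace W >= 1), dimension d = N*M*W;
  basis index of |i,z,w> is (i*M + z)*W + w. Vectors: nat => complex on {..<d};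
  matrices: nat => nat => complex on {..<d} x {..<d}.\<close>

definition mat_vec :: "nat \<Rightarrow> (nat \<Rightarrow> nat \<Rightarrow> complex) \<Rightarrow> (nat \<Rightarrow> complex) \<Rightarrow> nat \<Rightarrow> complex" where
  "mat_vec d U v = (\<lambda>a. \<Sum>b<d. U a b * v b)"

definition unitary_mat :: "nat \<Rightarrow> (nat \<Rightarrow> nat \<Rightarrow> complex) \<Rightarrow> bool" where
  "unitary_mat d U \<longleftrightarrow>
     (\<forall>a<d. \<forall>b<d. (\<Sum>c<d. cnj (U c a) * U c b) = (if a = b then 1 else 0))"

definition bidx :: "nat \<Rightarrow> nat \<Rightarrow> nat \<Rightarrow> nat \<Rightarrow> nat \<Rightarrow> nat" where
  "bidx M W i z w = (i * M + z) * W + w"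

definition query_op :: "nat \<Rightarrow> nat \<Rightarrow> nat list \<Rightarrow> nat \<Rightarrow> nat \<Rightarrow> complex" where
  "query_op M W X a b =
     (let i = b div (M * W); z = (b div W) mod M; w = b mod W
      in if a = bidx M W i ((z + lookup X i) mod M) w then 1 else 0)"

definition q_final :: "nat \<Rightarrow> nat \<Rightarrow> nat \<Rightarrow> nat list \<Rightarrow> (nat \<Rightarrow> nat \<Rightarrow> complex)
    \<Rightarrow> (nat \<Rightarrow> nat \<Rightarrow> complex) list \<Rightarrow> nat \<Rightarrow> complex" where
  "q_final N M W X U0 Us =
     foldl (\<lambda>v U. mat_vec (N*M*W) U (mat_vec (N*M*W) (query_op M W X) v))
           (mat_vec (N*M*W) U0 (\<lambda>a. if a = 0 then 1 else 0)) Us"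

text \<open>Algorithm U_T O ... O U_1 O U_0 applied to |0>, followed by a computational
  basis measurement, whose outcome b is mapped to the output bit out b.\<close>
definition q_prob :: "nat \<Rightarrow> nat \<Rightarrow> nat \<Rightarrow> nat list \<Rightarrow> (nat \<Rightarrow> nat \<Rightarrow> complex)
    \<Rightarrow> (nat \<Rightarrow> nat \<Rightarrow> complex) list \<Rightarrow> (nat \<Rightarrow> bool) \<Rightarrow> bool \<Rightarrow> real" where
  "q_prob N M W X U0 Us out r =
     (\<Sum>a \<in> {a. a < N*M*W \<and> out a = r}. (cmod (q_final N M W X U0 Us a))\<^sup>2)"

definition q_solves :: "nat \<Rightarrow> nat \<Rightarrow> (nat list \<Rightarrow> bool option) \<Rightarrow> nat \<Rightarrow> bool" where
  "q_solves N M f T \<longleftrightarrow>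
     (\<exists>W U0 Us out. W \<ge> 1 \<and> length Us = T \<and>
        unitary_mat (N*M*W) U0 \<and> (\<forall>U \<in> set Us. unitary_mat (N*M*W) U) \<and>
        (\<forall>X \<in> domset N M f. q_prob N M W X U0 Us out (the (f X)) \<ge> 2/3))"

definition Q_cplx :: "nat \<Rightarrow> nat \<Rightarrow> (nat list \<Rightarrow> bool option) \<Rightarrow> nat" where
  "Q_cplx N M f = (LEAST T. q_solves N M f T)"

end

theory Submission
  imports Defs
begin

text \<open>Let \<open>T = Q(f)\<close>. Replace the input \<open>x\<close> by \<open>x \<circ> \<pi> \<circ> h\<close>, where \<open>\<pi>\<close> is a random permutation of
  \<open>[N]\<close> and \<open>h\<close> a random function \<open>[N] \<rightarrow> [r]\<close> (Zhandry's small-range distributions, in the way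
  Chailloux applies them to symmetric functions); such an input is determined by \<open>r\<close> entries of \<open>x\<close>.
  Acceptance probabilities are sums of functions of at most \<open>2 T\<close> coordinates, so the average
  acceptance probability is a polynomial of degree \<open>O(T)\<close> in \<open>1/r\<close> whose value at \<open>0\<close> is the average
  over the inputs \<open>x \<circ> \<pi>\<close>, on which \<open>f\<close> has the value \<open>f x\<close>. A polynomial of degree \<open>D\<close> which is bounded
  by \<open>1\<close> at \<open>0\<close> and at all points \<open>1/k\<close> with \<open>k \<le> r\<close> changes by at most \<open>16 D\<^sup>5 / r\<close> between \<open>0\<close> and \<open>1/r\<close>.
  Hence \<open>r = O(T\<^sup>5)\<close> classical queries suffice.\<close>

section \<open>Sums of juntas\<close>

definition depends_on :: "nat set \<Rightarrow> ((nat \<Rightarrow> nat) \<Rightarrow> 'a) \<Rightarrow> bool" where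
  "depends_on S F \<longleftrightarrow> (\<forall>z z'. (\<forall>i\<in>S. z i = z' i) \<longrightarrow> F z = F z')"

lemma depends_onD: "depends_on S F \<Longrightarrow> (\<And>i. i \<in> S \<Longrightarrow> z i = z' i) \<Longrightarrow> F z = F z'"
  unfolding depends_on_def by blast

text \<open>The substitute for polynomial degree when coordinates take values in a large alphabet: a
  function has degree at most \<open>d\<close> when it is a finite sum of functions of at most
  \<open>d\<close> coordinates each. Inputs are functions rather than lists so that they can be
  composed with \<open>\<pi>\<close> and \<open>h\<close>; induction over the rules reduces linear
  claims to a single junta.\<close>

inductive junta_sum :: "nat \<Rightarrow> nat \<Rightarrow> ((nat \<Rightarrow> nat) \<Rightarrow> complex) \<Rightarrow> bool" for N d where
  junta: "S \<subseteq> {..<N} \<Longrightarrow> card S \<le> d \<Longrightarrow> depends_on S F \<Longrightarrow> junta_sum N d F"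
| add: "junta_sum N d F \<Longrightarrow> junta_sum N d G \<Longrightarrow> junta_sum N d (\<lambda>z. F z + G z)"

lemma junta_sum_const: "junta_sum N d (\<lambda>_. c)"
  by (rule junta_sum.junta[of "{}"]) (auto simp: depends_on_def)

lemma junta_sum_mono:
  assumes "junta_sum N d F" "d \<le> e"
  shows "junta_sum N e F"
  using assms by (induction rule: junta_sum.induct) (auto intro: junta_sum.intros)

lemma junta_sum_cnj: "junta_sum N d F \<Longrightarrow> junta_sum N d (\<lambda>z. cnj (F z))"
proof (induction rule: junta_sum.induct)
  case (junta S F)
  then show ?case
    by (intro junta_sum.junta[of S]) (auto simp: depends_on_def)
next
  case (add F G)
  then show ?case by (auto intro: junta_sum.add)
qed

text \<open>One half of a bilinear argument: a product of two juntas depends on the union of their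
  supports, and the sum in the second factor is distributed out. \<open>junta_sum_mult\<close> then
  distributes the first factor.\<close>

lemma junta_sum_mult_junta:
  assumes "junta_sum N e G" "S \<subseteq> {..<N}" "card S \<le> d" "depends_on S F"
  shows "junta_sum N (d + e) (\<lambda>z. F z * G z)"
  using assms(1)
proof (induction rule: junta_sum.induct)
  case (junta S' G)
  have "card (S \<union> S') \<le> d + e"
    using card_Un_le[of S S'] assms(3) junta(2) by linarith
  moreover have "depends_on (S \<union> S') (\<lambda>z. F z * G z)"
    using assms(4) junta(3) unfolding depends_on_def by (metis UnCI)
  ultimately show ?case
    using assms(2) junta(1) by (intro junta_sum.junta[of "S \<union> S'"]) auto
next
  case (add G G')
  then show ?case by (auto simp: distrib_left intro: junta_sum.add)
qed

lemma junta_sum_mult: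
  assumes "junta_sum N d F" "junta_sum N e G"
  shows "junta_sum N (d + e) (\<lambda>z. F z * G z)"
  using assms(1)
proof (induction rule: junta_sum.induct)
  case (junta S F)
  then show ?case by (intro junta_sum_mult_junta[OF assms(2)])
next
  case (add F F')
  then show ?case by (auto simp: distrib_right intro: junta_sum.add)
qed

lemma junta_sum_cmult: "junta_sum N d F \<Longrightarrow> junta_sum N d (\<lambda>z. c * F z)"
  using junta_sum_mult[OF junta_sum_const[of N 0 c]] by simp

lemma junta_sum_sum:
  assumes "\<And>a. a \<in> A \<Longrightarrow> junta_sum N d (F a)"
  shows "junta_sum N d (\<lambda>z. \<Sum>a\<in>A. F a z)"
  using assms
  by (induction A rule: infinite_finite_induct)
    (auto intro: junta_sum_const junta_sum.add)

text \<open>The column index \<open>b\<close> contains the address register, so the entry depends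
  only on the one coordinate at that address.\<close>

lemma junta_sum_query_op:
  assumes "b < N * M * W"
  shows "junta_sum N 1 (\<lambda>z. query_op M W (map z [0..<N]) a b)"
proof -
  have i: "b div (M * W) < N"
    using assms by (metis less_mult_imp_div_less mult.assoc)
  have "depends_on {b div (M * W)} (\<lambda>z. query_op M W (map z [0..<N]) a b)"
    using i by (auto simp: depends_on_def query_op_def lookup_def Let_def)
  then show ?thesis using i by (intro junta_sum.junta[of "{b div (M * W)}"]) auto
qed

text \<open>The polynomial method: the unitaries are linear maps with constant coefficients, so only
  a query raises the degree, and by one.\<close>

lemma junta_sum_q_final:
  "junta_sum N (length Us) (\<lambda>z. q_final N M W (map z [0..<N]) U0 Us a)"
proof (induction Us arbitrary: a rule: rev_induct)
  case Nil
  then show ?case by (simp add: q_final_def junta_sum_const)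
next
  case (snoc U Us)
  have "junta_sum N (1 + length Us) (\<lambda>z. \<Sum>b<N*M*W. U a b *
      (\<Sum>c<N*M*W. query_op M W (map z [0..<N]) b c * q_final N M W (map z [0..<N]) U0 Us c))"
    by (intro junta_sum_sum junta_sum_cmult junta_sum_mult junta_sum_query_op snoc) auto
  then show ?case by (simp add: q_final_def mat_vec_def)
qed

text \<open>A squared modulus is an amplitude times its conjugate, which doubles the degree.\<close>

lemma junta_sum_q_prob:
  "junta_sum N (2 * length Us)
     (\<lambda>z. complex_of_real (q_prob N M W (map z [0..<N]) U0 Us out r))"
proof -
  have "junta_sum N (length Us + length Us) (\<lambda>z. \<Sum>a\<in>{a. a < N*M*W \<and> out a = r}.
      q_final N M W (map z [0..<N]) U0 Us a * cnj (q_final N M W (map z [0..<N]) U0 Us a))"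
    by (intro junta_sum_sum junta_sum_mult junta_sum_cnj junta_sum_q_final)
  then show ?thesis
    by (simp add: q_prob_def complex_norm_square mult_2 del: of_real_power)
qed

text \<open>The success probability of a majority vote among three independent runs.\<close>

definition boost :: "'a::comm_ring_1 \<Rightarrow> 'a" where
  "boost p = 3 * (p * p) + (- 2) * (p * (p * p))"

lemma junta_sum_boost:
  assumes "junta_sum N d F"
  shows "junta_sum N (3 * d) (\<lambda>z. boost (F z))"
proof -
  have "junta_sum N (3 * d) (\<lambda>z. 3 * (F z * F z))"
    by (intro junta_sum_cmult junta_sum_mono[OF junta_sum_mult[OF assms assms]]) simp
  moreover have "junta_sum N (3 * d) (\<lambda>z. (- 2) * (F z * (F z * F z)))"
    by (intro junta_sum_cmult
        junta_sum_mono[OF junta_sum_mult[OF assms junta_sum_mult[OF assms assms]]]) simp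
  ultimately show ?thesis unfolding boost_def by (rule junta_sum.add)
qed

lemma boost_of_real: "boost (of_real p) = (of_real (boost p) :: complex)"
  by (simp add: boost_def)

lemma boost_diff: "boost (1 - p) = 1 - boost (p :: real)"
  by (simp add: boost_def algebra_simps)

lemma boost_mono:
  assumes "0 \<le> a" "a \<le> b" "b \<le> (1::real)"
  shows "boost a \<le> boost b"
proof -
  have "boost b - boost a = (b - a) * (3*(a+b) - 2*(a*a + a*b + b*b))"
    by (simp add: boost_def algebra_simps)
  \<comment> \<open>The last two bounds add up to \<open>2*a*b \<le> a + b\<close>; with the first
    two doubled, the second factor above is nonnegative.\<close>
  moreover have "a*a \<le> a" "b*b \<le> b" "a*b \<le> a" "a*b \<le> b"
    using assms mult_left_le[of b a] mult_left_le[of a a] mult_left_le[of b b] 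
      mult_left_le[of a b] by (auto simp: mult.commute)
  then have "0 \<le> 3*(a+b) - 2*(a*a + a*b + b*b)"
    using assms(1,2) unfolding distrib_left by linarith
  ultimately show ?thesis using assms(2) by (smt (verit) mult_nonneg_nonneg)
qed

text \<open>Three rounds carry 2/3 to 20/27, then above 33/40, then above 11/12; rejection follows
  from the symmetry \<open>boost_diff\<close>. The value 11/12 leaves room for a later error of
  1/12.\<close>

lemma boost3_bounds:
  fixes p :: real
  assumes "0 \<le> p" "p \<le> 1"
  shows "0 \<le> boost (boost (boost p))" "boost (boost (boost p)) \<le> 1"
    and "2/3 \<le> p \<Longrightarrow> 11/12 \<le> boost (boost (boost p))"
    and "p \<le> 1/3 \<Longrightarrow> boost (boost (boost p)) \<le> 1/12"
proof -
  have 0: "0 \<le> boost x \<and> boost x \<le> 1" if "0 \<le> x" "x \<le> 1" for x :: real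
    using boost_mono[of 0 x] boost_mono[of x 1] that by (auto simp: boost_def)
  show "0 \<le> boost (boost (boost p))" "boost (boost (boost p)) \<le> 1" using 0 assms by blast+
  have *: "11/12 \<le> boost (boost (boost x))" if "2/3 \<le> x" "x \<le> 1" for x :: real
  proof -
    have "20/27 \<le> boost x" using boost_mono[of "2/3" x] that by (simp add: boost_def)
    then have "33/40 \<le> boost (boost x)"
      using boost_mono[of "20/27" "boost x"] 0 that by (simp add: boost_def)
    then show ?thesis
      using boost_mono[of "33/40" "boost (boost x)"] 0 that by (simp add: boost_def)
  qed
  then show "2/3 \<le> p \<Longrightarrow> 11/12 \<le> boost (boost (boost p))" using assms by blast
  show "p \<le> 1/3 \<Longrightarrow> boost (boost (boost p)) \<le> 1/12"
    using *[of "1 - p"] assms by (simp add: boost_diff)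
qed

section \<open>Small-range distributions\<close>

lemma inj_on_extend_permutes:
  assumes "finite B" "A \<subseteq> B" "inj_on f A" "f ` A \<subseteq> B"
  shows "\<exists>p. p permutes B \<and> (\<forall>x\<in>A. p x = f x)"
proof -
  have "card (B - A) = card (B - f ` A)"
    using assms by (simp add: card_Diff_subset finite_subset card_image)
  then obtain g where g: "bij_betw g (B - A) (B - f ` A)"
    using assms(1) by (meson finite_Diff finite_same_card_bij)
  define p where "p x = (if x \<in> A then f x else if x \<in> B then g x else x)" for x
  have "bij_betw p (A \<union> (B - A)) (f ` A \<union> (B - f ` A))"
  proof (rule bij_betw_combine)
    show "bij_betw p A (f ` A)"
      using assms(3) by (auto simp: bij_betw_def p_def inj_on_def)
    show "bij_betw p (B - A) (B - f ` A)"
      using g by (rule bij_betw_cong[THEN iffD1, rotated]) (auto simp: p_def)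
  qed auto
  then have "bij_betw p B B" using assms(2,4) by (simp add: Un_absorb1)
  then have "p permutes B" by (rule bij_imp_permutes) (use assms(2) in \<open>auto simp: p_def\<close>)
  then show ?thesis by (intro exI[of _ p]) (auto simp: p_def)
qed

text \<open>Independent uniform values are drawn one coordinate at a time, so that an induction on
  the list can ask of each new value whether it repeats an earlier one. Coordinates outside the list
  keep the value given by \<open>h\<close>.\<close>

primrec rand_fill :: "nat \<Rightarrow> nat list \<Rightarrow> (nat \<Rightarrow> nat) \<Rightarrow> (nat \<Rightarrow> nat) pmf" where
  "rand_fill r [] h = return_pmf h"
| "rand_fill r (x # L) h = pmf_of_set {..<r} \<bind> (\<lambda>v. rand_fill r L (h(x := v)))"

lemma finite_set_rand_fill: "0 < r \<Longrightarrow> finite (set_pmf (rand_fill r L h))"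
  by (induction L arbitrary: h) (auto simp: set_bind_pmf lessThan_empty_iff)

lemma rand_fill_bound:
  assumes "0 < r" "h' \<in> set_pmf (rand_fill r L h)" "\<And>i. i \<notin> set L \<Longrightarrow> h i < r"
  shows "h' i < r"
  using assms(2,3)
proof (induction L arbitrary: h)
  case Nil
  then show ?case by simp
next
  case (Cons x L)
  then obtain v where v: "v < r" "h' \<in> set_pmf (rand_fill r L (h(x := v)))"
    using assms(1) by (auto simp: set_bind_pmf lessThan_empty_iff)
  show ?case by (rule Cons.IH[OF v(2)]) (use v(1) Cons.prems(2) in auto)
qed

lemma expectation_rand_fill_Cons:
  fixes \<Phi> :: "(nat \<Rightarrow> nat) \<Rightarrow> complex"
  assumes "0 < r"
  shows "measure_pmf.expectation (rand_fill r (x # L) h) \<Phi>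
    = (\<Sum>v<r. measure_pmf.expectation (rand_fill r L (h(x := v))) \<Phi>) / of_nat r"
  using assms
  by (simp add: pmf_expectation_bind_pmf_of_set finite_set_rand_fill lessThan_empty_iff
      scaleR_conv_of_real sum_distrib_left divide_inverse mult.commute)

lemma expectation_rand_fill_cong:
  fixes \<Phi> :: "(nat \<Rightarrow> nat) \<Rightarrow> complex"
  assumes "0 < r" "depends_on S \<Phi>" "\<And>i. i \<in> S - set L \<Longrightarrow> h i = h' i"
  shows "measure_pmf.expectation (rand_fill r L h) \<Phi> = measure_pmf.expectation (rand_fill r L h') \<Phi>"
  using assms(3)
proof (induction L arbitrary: h h')
  case Nil
  then have "\<Phi> h = \<Phi> h'" by (intro depends_onD[OF assms(2)]) auto
  then show ?case by simp
next
  case (Cons x L)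
  have "measure_pmf.expectation (rand_fill r L (h(x := v))) \<Phi>
      = measure_pmf.expectation (rand_fill r L (h'(x := v))) \<Phi>" for v
    by (rule Cons.IH) (use Cons.prems in auto)
  then show ?case by (simp add: expectation_rand_fill_Cons[OF assms(1)] del: rand_fill.simps)
qed

text \<open>If \<open>v\<close> is uniform on \<open>{..<r}\<close> then so is
  \<open>\<rho> v\<close>; hence the relabelling can be pushed through each sampled coordinate until
  the invariance of \<open>\<Phi>\<close> absorbs it.\<close>

lemma expectation_rand_fill_permute:
  fixes \<Phi> :: "(nat \<Rightarrow> nat) \<Rightarrow> complex"
  assumes "0 < r" "\<rho> permutes {..<r}" "\<And>h. \<Phi> (\<rho> \<circ> h) = \<Phi> h"
  shows "measure_pmf.expectation (rand_fill r L (\<rho> \<circ> h)) \<Phi> = measure_pmf.expectation (rand_fill r L h) \<Phi>"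
proof (induction L arbitrary: h)
  case Nil
  then show ?case using assms(3) by (simp add: o_def)
next
  case (Cons x L)
  have "(\<Sum>v<r. measure_pmf.expectation (rand_fill r L ((\<rho> \<circ> h)(x := v))) \<Phi>)
      = (\<Sum>v<r. measure_pmf.expectation (rand_fill r L ((\<rho> \<circ> h)(x := \<rho> v))) \<Phi>)"
    using sum.permute[OF assms(2), of "\<lambda>v. measure_pmf.expectation (rand_fill r L ((\<rho> \<circ> h)(x := v))) \<Phi>"]
    by (simp add: o_def)
  also have "\<dots> = (\<Sum>v<r. measure_pmf.expectation (rand_fill r L (\<rho> \<circ> h(x := v))) \<Phi>)"
    by (simp only: fun_upd_comp)
  also have "\<dots> = (\<Sum>v<r. measure_pmf.expectation (rand_fill r L (h(x := v))) \<Phi>)"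
    by (simp only: Cons.IH)
  finally show ?case
    by (simp only: expectation_rand_fill_Cons[OF assms(1)])
qed

text \<open>Induction on \<open>L\<close>: the next coordinate receives either one of the \<open>b\<close> values used so far or a fresh
  one, and by symmetry all \<open>r - b\<close> fresh values contribute the same. In the limit \<open>1/r \<rightarrow> 0\<close> only
  the injective assignments \<open>h'\<close> survive.\<close>

lemma expectation_rand_fill_poly:
  fixes \<Phi> :: "(nat \<Rightarrow> nat) \<Rightarrow> complex"
  assumes dep: "depends_on S \<Phi>"
    and inv: "\<And>\<rho> h. \<rho> permutes {..<N} \<Longrightarrow> \<Phi> (\<rho> \<circ> h) = \<Phi> h"
    and "distinct L" "\<And>i. i \<in> S - set L \<Longrightarrow> h i < b" "b + card (S \<inter> set L) \<le> N"
  shows "\<exists>p h'. degree p \<le> card (S \<inter> set L) \<and> poly p 0 = \<Phi> h' \<and>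
      (\<forall>i\<in>S - set L. h' i = h i) \<and> inj_on h' (S \<inter> set L) \<and> h' ` (S \<inter> set L) \<subseteq> {b..<N} \<and>
      (\<forall>r. 1 \<le> r \<and> b \<le> r \<and> r \<le> N \<longrightarrow>
        measure_pmf.expectation (rand_fill r L h) \<Phi> = poly p (1 / of_nat r))"
  using assms(3-)
proof (induction L arbitrary: h b)
  case Nil
  show ?case by (rule exI[of _ "[:\<Phi> h:]"], rule exI[of _ h]) auto
next
  case (Cons x L)
  let ?E = "\<lambda>r L h. measure_pmf.expectation (rand_fill r L h) \<Phi>"
  show ?case
  proof (cases "x \<in> S")
    case False
    then have S: "S \<inter> set (x # L) = S \<inter> set L" "S - set (x # L) = S - set L" by auto
    have "\<exists>p h'. degree p \<le> card (S \<inter> set L) \<and> poly p 0 = \<Phi> h' \<and>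
      (\<forall>i\<in>S - set L. h' i = h i) \<and> inj_on h' (S \<inter> set L) \<and> h' ` (S \<inter> set L) \<subseteq> {b..<N} \<and>
      (\<forall>r. 1 \<le> r \<and> b \<le> r \<and> r \<le> N \<longrightarrow> ?E r L h = poly p (1 / of_nat r))"
      by (rule Cons.IH) (use Cons.prems S in auto)
    moreover have "?E r (x # L) h = ?E r L h" if "1 \<le> r" for r
    proof -
      have "?E r L (h(x := v)) = ?E r L h" for v
        by (rule expectation_rand_fill_cong[OF _ dep]) (use that False in auto)
      then show ?thesis using that
        by (simp add: expectation_rand_fill_Cons del: rand_fill.simps)
    qed
    ultimately show ?thesis unfolding S by metis
  next
    case True
    let ?c = "card (S \<inter> set L)"
    have SL: "S \<inter> set (x # L) = insert x (S \<inter> set L)" using True by auto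
    have x: "x \<notin> S \<inter> set L" using Cons.prems(1) by auto
    have card: "card (S \<inter> set (x # L)) = Suc ?c" unfolding SL using x by simp
    \<comment> \<open>A repeated value: the set of used labels stays within
      \<open>{..<b}\<close>.\<close>
    have "\<exists>p. degree p \<le> ?c \<and>
        (\<forall>r. 1 \<le> r \<and> b \<le> r \<and> r \<le> N \<longrightarrow> ?E r L (h(x := v)) = poly p (1 / of_nat r))"
      if "v < b" for v
    proof -
      have "\<exists>p h'. degree p \<le> ?c \<and> poly p 0 = \<Phi> h' \<and>
        (\<forall>i\<in>S - set L. h' i = (h(x := v)) i) \<and> inj_on h' (S \<inter> set L) \<and> h' ` (S \<inter> set L) \<subseteq> {b..<N} \<and>
        (\<forall>r. 1 \<le> r \<and> b \<le> r \<and> r \<le> N \<longrightarrow> ?E r L (h(x := v)) = poly p (1 / of_nat r))"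
        by (rule Cons.IH) (use Cons.prems card that in auto)
      then show ?thesis by blast
    qed
    then obtain q where q: "\<And>v. v < b \<Longrightarrow> degree (q v) \<le> ?c"
      "\<And>v r. v < b \<Longrightarrow> 1 \<le> r \<Longrightarrow> b \<le> r \<Longrightarrow> r \<le> N \<Longrightarrow> ?E r L (h(x := v)) = poly (q v) (1 / of_nat r)"
      by metis
    have "\<exists>p h'. degree p \<le> ?c \<and> poly p 0 = \<Phi> h' \<and>
      (\<forall>i\<in>S - set L. h' i = (h(x := b)) i) \<and> inj_on h' (S \<inter> set L) \<and>
      h' ` (S \<inter> set L) \<subseteq> {Suc b..<N} \<and>
      (\<forall>r. 1 \<le> r \<and> Suc b \<le> r \<and> r \<le> N \<longrightarrow> ?E r L (h(x := b)) = poly p (1 / of_nat r))"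
      by (rule Cons.IH) (use Cons.prems card in \<open>auto simp: less_Suc_eq\<close>)
    then obtain q' h' where q': "degree q' \<le> ?c" "poly q' 0 = \<Phi> h'"
        "\<And>r. 1 \<le> r \<Longrightarrow> Suc b \<le> r \<Longrightarrow> r \<le> N \<Longrightarrow> ?E r L (h(x := b)) = poly q' (1 / of_nat r)"
      and h': "\<forall>i\<in>S - set L. h' i = (h(x := b)) i" "inj_on h' (S \<inter> set L)"
        "h' ` (S \<inter> set L) \<subseteq> {Suc b..<N}"
      by blast
    have h'x: "h' x = b" using h'(1) True Cons.prems(1) by auto
    \<comment> \<open>With \<open>t = 1/r\<close> this is
      \<open>t * (\<Sum>v<b. q v) + (1 - b * t) * q'\<close>: each used label has probability
      \<open>t\<close>, the fresh ones together \<open>1 - b * t\<close>. Both summands gain one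
      degree, and at \<open>t = 0\<close> only \<open>q'\<close> remains.\<close>
    define p where "p = pCons 0 (\<Sum>v<b. q v) + [:1, - of_nat b:] * q'"
    have "degree p \<le> Suc ?c"
    proof -
      have "degree (\<Sum>v<b. q v) \<le> ?c" by (intro degree_sum_le) (auto simp: q(1))
      then have "degree (pCons 0 (\<Sum>v<b. q v)) \<le> Suc ?c"
        by (meson degree_pCons_le le_trans Suc_le_mono)
      moreover have "degree ([:1, - of_nat b:] * q') \<le> Suc ?c"
        using degree_mult_le[of "[:1, - of_nat b:]" q'] q'(1)
          degree_pCons_le[of 1 "[:- of_nat b :: complex:]"] by simp
      ultimately show ?thesis unfolding p_def by (rule degree_add_le)
    qed
    moreover have "poly p 0 = \<Phi> h'" by (simp add: p_def q'(2))
    moreover have "\<forall>i\<in>S - set (x # L). h' i = h i" using h'(1) by auto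
    moreover have "inj_on h' (S \<inter> set (x # L))"
      unfolding SL using h'(2,3) h'x x by (auto simp: inj_on_insert)
    moreover have "h' ` (S \<inter> set (x # L)) \<subseteq> {b..<N}"
      unfolding SL using h'(3) h'x Cons.prems(3) card by auto
    moreover have "?E r (x # L) h = poly p (1 / of_nat r)" if r: "1 \<le> r" "b \<le> r" "r \<le> N" for r
    proof -
      \<comment> \<open>Exchanging \<open>b\<close> and \<open>v\<close> fixes every used label,
        since these are all below \<open>b\<close>.\<close>
      have fresh: "?E r L (h(x := v)) = ?E r L (h(x := b))" if v: "b \<le> v" "v < r" for v
      proof -
        let ?\<rho> = "Transposition.transpose b v"
        have \<rho>: "?\<rho> permutes {..<r}" using v by (intro permutes_swap_id) auto
        then have "?\<rho> permutes {..<N}" by (rule permutes_subset) (use r in auto)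
        then have "?E r L (?\<rho> \<circ> h(x := b)) = ?E r L (h(x := b))"
          using r(1) \<rho> inv by (intro expectation_rand_fill_permute) auto
        moreover have "?E r L (h(x := v)) = ?E r L (?\<rho> \<circ> h(x := b))"
        proof (rule expectation_rand_fill_cong[OF _ dep])
          fix i assume "i \<in> S - set L"
          then have "i = x \<or> h i < b" using Cons.prems(2)[of i] by auto
          then show "(h(x := v)) i = (?\<rho> \<circ> h(x := b)) i"
            using v(1) by (auto simp: transpose_apply_other)
        qed (use r in simp)
        ultimately show ?thesis by simp
      qed
      have eq: "{..<r} = {..<b} \<union> {b..<r}" using r(2) by auto
      have "(\<Sum>v<r. ?E r L (h(x := v)))
          = (\<Sum>v<b. ?E r L (h(x := v))) + (\<Sum>v=b..<r. ?E r L (h(x := v)))"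
        unfolding eq by (rule sum.union_disjoint) auto
      also have "(\<Sum>v<b. ?E r L (h(x := v))) = (\<Sum>v<b. poly (q v) (1 / of_nat r))"
        using q(2) r by (intro sum.cong) auto
      also have "(\<Sum>v=b..<r. ?E r L (h(x := v))) = (\<Sum>v=b..<r. ?E r L (h(x := b)))"
        by (intro sum.cong fresh) auto
      also have "\<dots> = of_nat (r - b) * ?E r L (h(x := b))" by simp
      \<comment> \<open>For \<open>r = b\<close> there is no fresh label and \<open>q'\<close> says
        nothing about this \<open>r\<close>, but the factor \<open>r - b\<close> is then
        zero.\<close>
      also have "\<dots> = of_nat (r - b) * poly q' (1 / of_nat r)"
        using q'(3)[of r] r by (cases "b = r") auto
      also have "of_nat (r - b) = (of_nat r - of_nat b :: complex)"
        using r(2) by (simp add: of_nat_diff)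
      finally have sum: "(\<Sum>v<r. ?E r L (h(x := v)))
          = (\<Sum>v<b. poly (q v) (1 / of_nat r)) + (of_nat r - of_nat b) * poly q' (1 / of_nat r)" .
      have "0 < r" using r(1) by simp
      then show ?thesis
        unfolding expectation_rand_fill_Cons[OF \<open>0 < r\<close>] sum
        by (simp add: p_def poly_sum field_simps)
    qed
    ultimately show ?thesis unfolding card by blast
  qed
qed

section \<open>Averaging over random permutations and small-range functions\<close>

definition perms :: "nat \<Rightarrow> (nat \<Rightarrow> nat) pmf" where
  "perms N = pmf_of_set {\<pi>. \<pi> permutes {..<N}}"

lemma permutes_lessThan_fin: "finite {\<pi>. \<pi> permutes {..<N::nat}}" "{\<pi>. \<pi> permutes {..<N::nat}} \<noteq> {}"
  by (auto intro: finite_permutations permutes_id)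

lemma set_perms [simp]: "set_pmf (perms N) = {\<pi>. \<pi> permutes {..<N}}"
  using permutes_lessThan_fin by (simp add: perms_def)

lemma expectation_perms:
  fixes F :: "(nat \<Rightarrow> nat) \<Rightarrow> complex"
  shows "measure_pmf.expectation (perms N) F
    = (\<Sum>\<pi> | \<pi> permutes {..<N}. F \<pi>) / of_nat (card {\<pi>. \<pi> permutes {..<N}})"
  unfolding perms_def
  by (subst integral_measure_pmf[of "{\<pi>. \<pi> permutes {..<N}}"])
    (use permutes_lessThan_fin in \<open>auto simp: sum_distrib_right scaleR_conv_of_real divide_inverse mult.commute\<close>)

definition small_range :: "nat \<Rightarrow> nat \<Rightarrow> ((nat \<Rightarrow> nat) \<times> (nat \<Rightarrow> nat)) pmf" where
  "small_range N r = pair_pmf (rand_fill r [0..<N] (\<lambda>_. 0)) (perms N)"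

lemma finite_set_small_range: "0 < r \<Longrightarrow> finite (set_pmf (small_range N r))"
  using permutes_lessThan_fin by (simp add: small_range_def finite_set_rand_fill)

lemma small_range_bound: "0 < r \<Longrightarrow> (h, \<pi>) \<in> set_pmf (small_range N r) \<Longrightarrow> h i < r \<and> \<pi> permutes {..<N}"
  using rand_fill_bound[of r h "[0..<N]" "\<lambda>_. 0" i] by (auto simp: small_range_def)

lemma expectation_small_range:
  fixes F :: "(nat \<Rightarrow> nat) \<times> (nat \<Rightarrow> nat) \<Rightarrow> complex"
  assumes "0 < r"
  shows "measure_pmf.expectation (small_range N r) F = measure_pmf.expectation
    (rand_fill r [0..<N] (\<lambda>_. 0)) (\<lambda>h. measure_pmf.expectation (perms N) (\<lambda>\<pi>. F (h, \<pi>)))"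
proof -
  let ?A = "set_pmf (rand_fill r [0..<N] (\<lambda>_. 0))" and ?B = "{\<pi>. \<pi> permutes {..<N}}"
  have fin: "finite ?A" "finite ?B" using assms permutes_lessThan_fin by (auto simp: finite_set_rand_fill)
  have "measure_pmf.expectation (small_range N r) F = (\<Sum>z\<in>?A \<times> ?B. pmf (small_range N r) z *\<^sub>R F z)"
    by (rule integral_measure_pmf) (use fin in \<open>auto simp: small_range_def\<close>)
  also have "\<dots> = (\<Sum>h\<in>?A. \<Sum>\<pi>\<in>?B. pmf (small_range N r) (h, \<pi>) *\<^sub>R F (h, \<pi>))"
    by (simp add: sum.cartesian_product)
  also have "\<dots> = (\<Sum>h\<in>?A. pmf (rand_fill r [0..<N] (\<lambda>_. 0)) h *\<^sub>R (\<Sum>\<pi>\<in>?B. pmf (perms N) \<pi> *\<^sub>R F (h, \<pi>)))"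
    by (simp add: small_range_def pmf_pair scaleR_sum_right)
  also have "\<dots> = (\<Sum>h\<in>?A. pmf (rand_fill r [0..<N] (\<lambda>_. 0)) h *\<^sub>R
      measure_pmf.expectation (perms N) (\<lambda>\<pi>. F (h, \<pi>)))"
    using fin by (subst integral_measure_pmf[of ?B]) auto
  also have "\<dots> = measure_pmf.expectation (rand_fill r [0..<N] (\<lambda>_. 0))
      (\<lambda>h. measure_pmf.expectation (perms N) (\<lambda>\<pi>. F (h, \<pi>)))"
    by (rule integral_measure_pmf[symmetric]) (use fin in auto)
  finally show ?thesis .
qed

text \<open>For one junta, averaging over \<open>\<pi>\<close> makes the value depend on
  \<open>h\<close> only up to relabelling, because \<open>\<rho>\<close> in
  \<open>\<pi> \<circ> \<rho> \<circ> h\<close> is absorbed by reindexing the permutations. So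
  \<open>expectation_rand_fill_poly\<close> applies with no label used at the start. Sums follow by
  linearity.\<close>

lemma expectation_small_range_poly:
  assumes "junta_sum N d F"
  shows "\<exists>p. degree p \<le> d \<and> poly p 0 = measure_pmf.expectation (perms N) (\<lambda>\<pi>. F (x \<circ> \<pi>)) \<and>
    (\<forall>r. 1 \<le> r \<and> r \<le> N \<longrightarrow>
      measure_pmf.expectation (small_range N r) (\<lambda>(h, \<pi>). F (x \<circ> \<pi> \<circ> h)) = poly p (1 / of_nat r))"
  using assms
proof (induction rule: junta_sum.induct)
  case (junta S F)
  define \<Phi> where "\<Phi> h = measure_pmf.expectation (perms N) (\<lambda>\<pi>. F (x \<circ> \<pi> \<circ> h))" for h
  have dep: "depends_on S \<Phi>"
    unfolding depends_on_def
  proof (intro allI impI)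
    fix h h' :: "nat \<Rightarrow> nat" assume "\<forall>i\<in>S. h i = h' i"
    then have "F (x \<circ> \<pi> \<circ> h) = F (x \<circ> \<pi> \<circ> h')" for \<pi>
      by (intro depends_onD[OF junta(3)]) auto
    then show "\<Phi> h = \<Phi> h'" by (simp add: \<Phi>_def)
  qed
  have inv: "\<Phi> (\<rho> \<circ> h) = \<Phi> h" if "\<rho> permutes {..<N}" for \<rho> h
    unfolding \<Phi>_def expectation_perms
    using sum_permutations_compose_right[OF that, of "\<lambda>\<pi>. F (x \<circ> \<pi> \<circ> h)"]
    by (simp add: comp_assoc)
  have S: "S \<inter> set [0..<N] = S" "S - set [0..<N] = {}" using junta(1) by auto
  have "card S \<le> N" using card_mono[OF _ junta(1)] by simp
  then have "\<exists>p h'. degree p \<le> card (S \<inter> set [0..<N]) \<and> poly p 0 = \<Phi> h' \<and>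
      (\<forall>i\<in>S - set [0..<N]. h' i = 0) \<and> inj_on h' (S \<inter> set [0..<N]) \<and>
      h' ` (S \<inter> set [0..<N]) \<subseteq> {0..<N} \<and>
      (\<forall>r. 1 \<le> r \<and> 0 \<le> r \<and> r \<le> N \<longrightarrow>
        measure_pmf.expectation (rand_fill r [0..<N] (\<lambda>_. 0)) \<Phi> = poly p (1 / of_nat r))"
    by (intro expectation_rand_fill_poly[OF dep inv]) (use S in auto)
  then obtain p h' where p: "degree p \<le> card S" "poly p 0 = \<Phi> h'"
      "\<And>r. 1 \<le> r \<Longrightarrow> r \<le> N \<Longrightarrow>
        measure_pmf.expectation (rand_fill r [0..<N] (\<lambda>_. 0)) \<Phi> = poly p (1 / of_nat r)"
    and h': "inj_on h' S" "h' ` S \<subseteq> {..<N}"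
    unfolding S by (auto simp: lessThan_atLeast0)
  \<comment> \<open>The limit at 0 is \<open>\<Phi>\<close> at an injective assignment; extended to
    a permutation, it can be replaced by the identity.\<close>
  obtain \<rho> where \<rho>: "\<rho> permutes {..<N}" "\<forall>i\<in>S. \<rho> i = h' i"
    using inj_on_extend_permutes[OF _ junta(1) h'] by auto
  have "\<Phi> h' = \<Phi> (\<rho> \<circ> id)" by (rule depends_onD[OF dep]) (use \<rho>(2) in auto)
  also have "\<dots> = \<Phi> id" by (rule inv[OF \<rho>(1)])
  finally have "poly p 0 = measure_pmf.expectation (perms N) (\<lambda>\<pi>. F (x \<circ> \<pi>))"
    using p(2) by (simp add: \<Phi>_def)
  then show ?case
    using p(1,3) junta(2) by (intro exI[of _ p]) (auto simp: expectation_small_range \<Phi>_def[abs_def] o_def)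
next
  case (add F G)
  obtain p where p: "degree p \<le> d" "poly p 0 = measure_pmf.expectation (perms N) (\<lambda>\<pi>. F (x \<circ> \<pi>))"
    "\<And>r. 1 \<le> r \<Longrightarrow> r \<le> N \<Longrightarrow>
      measure_pmf.expectation (small_range N r) (\<lambda>(h, \<pi>). F (x \<circ> \<pi> \<circ> h)) = poly p (1 / of_nat r)"
    using add.IH(1) by blast
  obtain q where q: "degree q \<le> d" "poly q 0 = measure_pmf.expectation (perms N) (\<lambda>\<pi>. G (x \<circ> \<pi>))"
    "\<And>r. 1 \<le> r \<Longrightarrow> r \<le> N \<Longrightarrow>
      measure_pmf.expectation (small_range N r) (\<lambda>(h, \<pi>). G (x \<circ> \<pi> \<circ> h)) = poly q (1 / of_nat r)"
    using add.IH(2) by blast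
  have "measure_pmf.expectation (perms N) (\<lambda>\<pi>. F (x \<circ> \<pi>) + G (x \<circ> \<pi>)) = poly (p + q) 0"
    using permutes_lessThan_fin
    by (subst Bochner_Integration.integral_add) (auto intro: integrable_measure_pmf_finite simp: p q)
  moreover have "measure_pmf.expectation (small_range N r)
      (\<lambda>(h, \<pi>). F (x \<circ> \<pi> \<circ> h) + G (x \<circ> \<pi> \<circ> h)) = poly (p + q) (1 / of_nat r)"
    if "1 \<le> r" "r \<le> N" for r
    unfolding case_prod_unfold
    by (subst Bochner_Integration.integral_add)
      (use that p(3)[OF that] q(3)[OF that] in
        \<open>auto intro!: integrable_measure_pmf_finite finite_set_small_range simp: case_prod_unfold\<close>)
  ultimately show ?case
    using p(1) q(1) by (intro exI[of _ "p + q"]) (auto intro: degree_add_le simp: o_def)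
qed

section \<open>Polynomials bounded at reciprocals of integers\<close>

lemma lagrange_eval:
  fixes p :: "'a::field poly"
  assumes A: "finite A" "degree p < card A"
  shows "poly p x = (\<Sum>a\<in>A. poly p a * (\<Prod>b\<in>A - {a}. (x - b) / (a - b)))"
proof -
  define q where "q = (\<Sum>a\<in>A. smult (poly p a) (\<Prod>b\<in>A - {a}. [:- b / (a - b), 1 / (a - b):]))"
  have q: "poly q y = (\<Sum>a\<in>A. poly p a * (\<Prod>b\<in>A - {a}. (y - b) / (a - b)))" for y
    by (simp add: q_def poly_sum poly_prod diff_divide_distrib)
  have "degree (\<Prod>b\<in>A - {a}. [:- b / (a - b), 1 / (a - b):]) \<le> card A - 1" if "a \<in> A" for a
  proof -
    have "degree (\<Prod>b\<in>A - {a}. [:- b / (a - b), 1 / (a - b):])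
        \<le> (\<Sum>b\<in>A - {a}. degree [:- b / (a - b), 1 / (a - b):])"
      using degree_prod_sum_le[of "A - {a}" "\<lambda>b. [:- b / (a - b), 1 / (a - b):]"] A(1)
      by (simp add: o_def)
    also have "\<dots> \<le> (\<Sum>b\<in>A - {a}. 1)" by (intro sum_mono) simp
    also have "\<dots> = card A - 1" using that A(1) by simp
    finally show ?thesis .
  qed
  then have "degree q \<le> card A - 1"
    unfolding q_def
    by (intro degree_sum_le A(1)) (meson degree_smult_le le_trans)
  moreover have "poly p y = poly q y" if "y \<in> A" for y
  proof -
    have "(\<Prod>b\<in>A - {a}. (y - b) / (a - b)) = (if a = y then 1 else 0)" if "a \<in> A" for a
      using \<open>y \<in> A\<close> A(1) by (auto intro!: prod.neutral)
    then have "poly q y = (\<Sum>a\<in>A. poly p a * (if a = y then 1 else 0))"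
      unfolding q by (intro sum.cong) auto
    then show ?thesis using that A(1) by (simp add: if_distrib cong: if_cong)
  qed
  ultimately have "p = q" using A(2) by (intro poly_eqI_degree[of A]) auto
  then show ?thesis unfolding q[symmetric] by simp
qed

text \<open>Maximality of the central binomial coefficient of \<open>2 * D\<close>: passing from
  \<open>j\<close> to \<open>Suc j\<close> trades the factor \<open>D - j\<close> for the larger
  \<open>D + j + 1\<close>.\<close>

lemma fact_sq_le: "j \<le> D \<Longrightarrow> (fact D)\<^sup>2 \<le> (fact (D - j) * fact (D + j) :: real)"
proof (induction j)
  case 0
  then show ?case by (simp add: power2_eq_square)
next
  case (Suc j)
  have e: "fact (D - j) = real (D - j) * fact (D - Suc j)"
    using Suc.prems by (metis Suc_diff_Suc Suc_le_eq fact_Suc)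
  have "(fact D)\<^sup>2 \<le> fact (D - j) * (fact (D + j) :: real)" using Suc by simp
  also have "\<dots> = fact (D - Suc j) * (real (D - j) * fact (D + j))" by (simp add: e)
  also have "\<dots> \<le> fact (D - Suc j) * (real (Suc (D + j)) * fact (D + j))"
    by (intro mult_left_mono mult_right_mono) auto
  finally show ?case by (simp add: mult_ac)
qed

lemma prod_abs_diff:
  assumes "1 \<le> j" "j \<le> D"
  shows "(\<Prod>i\<in>{1..D} - {j}. \<bar>real i - real j\<bar>) = fact (j - 1) * fact (D - j)"
proof -
  have eq: "{1..D} - {j} = {1..<j} \<union> {j<..D}" using assms by auto
  have "(\<Prod>i\<in>{1..D} - {j}. \<bar>real i - real j\<bar>)
      = (\<Prod>i\<in>{1..<j}. \<bar>real i - real j\<bar>) * (\<Prod>i\<in>{j<..D}. \<bar>real i - real j\<bar>)"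
    unfolding eq by (rule prod.union_disjoint) auto
  also have "(\<Prod>i\<in>{1..<j}. \<bar>real i - real j\<bar>) = (\<Prod>i\<in>{1..j-1}. real i)"
    by (rule prod.reindex_bij_witness[of _ "\<lambda>i. j - i" "\<lambda>i. j - i"]) auto
  also have "(\<Prod>i\<in>{j<..D}. \<bar>real i - real j\<bar>) = (\<Prod>i\<in>{1..D-j}. real i)"
    by (rule prod.reindex_bij_witness[of _ "\<lambda>i. i + j" "\<lambda>i. i - j"]) auto
  finally show ?thesis by (simp add: fact_prod)
qed

text \<open>The omitted factor at \<open>i = j\<close> is \<open>2 * j\<close>; restoring it gives
  the product from \<open>j + 1\<close> to \<open>D + j\<close>, and \<open>fact j\<close> supplies
  the rest.\<close>

lemma prod_sum_ge:
  assumes "1 \<le> j" "j \<le> D"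
  shows "(\<Prod>i\<in>{1..D} - {j}. real i + real j) * (2 * real j * fact j) = fact (D + j)"
proof -
  have "(\<Prod>i\<in>{1..D} - {j}. real i + real j) * (2 * real j) = (\<Prod>i\<in>{1..D}. real i + real j)"
    using assms prod.remove[of "{1..D}" j "\<lambda>i. real i + real j"] by simp
  also have "\<dots> = (\<Prod>i\<in>{j+1..D+j}. real i)"
    by (rule prod.reindex_bij_witness[of _ "\<lambda>i. i - j" "\<lambda>i. i + j"]) auto
  finally have *: "(\<Prod>i\<in>{1..D} - {j}. real i + real j) * (2 * real j)
      = (\<Prod>i\<in>{j+1..D+j}. real i)" .
  have "fact j * (\<Prod>i\<in>{j+1..D+j}. real i) = (\<Prod>i\<in>{1..j}\<union>{j+1..D+j}. real i)"
    by (subst prod.union_disjoint) (auto simp: fact_prod)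
  also have "{1..j} \<union> {j+1..D+j} = {1..D+j}" by auto
  also have "(\<Prod>i\<in>{1..D+j}. real i) = fact (D + j)" by (simp add: fact_prod)
  finally show ?thesis using * by (simp add: mult_ac)
qed

text \<open>This is the absolute value of the Lagrange coefficient at 0 for the nodes 1, 4, ...,
  \<open>D\<^sup>2\<close>. It equals
  \<open>2 * (fact D)\<^sup>2 / (fact (D - j) * fact (D + j))\<close>.\<close>

lemma prod_sq_ratio_le:
  assumes "1 \<le> j" "j \<le> D"
  shows "(\<Prod>i\<in>{1..D} - {j}. (real i)\<^sup>2 / \<bar>(real i)\<^sup>2 - (real j)\<^sup>2\<bar>) \<le> 2"
proof -
  let ?A = "{1..D} - {j}"
  have "(\<Prod>i\<in>?A. real i) * real j = fact D"
    using assms prod.remove[of "{1..D}" j real] by (simp add: fact_prod mult.commute)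
  then have num: "(\<Prod>i\<in>?A. real i) = fact D / real j"
    using assms by (simp add: field_simps)
  have den: "(\<Prod>i\<in>?A. real i + real j) = fact (D + j) / (2 * real j * fact j)"
    using prod_sum_ge[OF assms] assms by (simp add: field_simps)
  have fj: "fact j = real j * fact (j - 1)"
    using assms by (metis fact_reduce less_eq_Suc_le One_nat_def of_nat_id)
  have "(\<Prod>i\<in>?A. (real i)\<^sup>2 / \<bar>(real i)\<^sup>2 - (real j)\<^sup>2\<bar>)
      = (\<Prod>i\<in>?A. (real i)\<^sup>2 / (\<bar>real i - real j\<bar> * (real i + real j)))"
    by (intro prod.cong refl) (simp add: power2_eq_square square_diff_square_factored abs_mult mult.commute)
  also have "\<dots> = (fact D / real j)\<^sup>2
      / (fact (j - 1) * fact (D - j) * (fact (D + j) / (2 * real j * fact j)))"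
    by (simp add: prod_dividef prod.distrib prod_power_distrib[symmetric] num den prod_abs_diff[OF assms]
        del: One_nat_def)
  also have "\<dots> = 2 * ((fact D)\<^sup>2 / (fact (D - j) * fact (D + j)))"
    using assms by (simp add: fj field_simps power2_eq_square)
  also have "\<dots> \<le> 2"
    using fact_sq_le[OF assms(2)] by (simp add: divide_le_eq)
  finally show ?thesis .
qed

section \<open>Interpolation nodes rounded to reciprocals of integers\<close>

text \<open>The reciprocals of the nodes \<open>node D j\<close> are approximately proportional to \<open>j\<^sup>2\<close>, the
  clustering near 0 that keeps the Lagrange coefficients bounded; the scale \<open>2 * D ^ 4\<close> makes the
  rounding harmless.\<close>

definition node :: "nat \<Rightarrow> nat \<Rightarrow> nat" where
  "node D j = 2 * D ^ 4 div j\<^sup>2"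

lemma node_le: "1 \<le> j \<Longrightarrow> real (node D j) \<le> 2 * real D ^ 4 / (real j)\<^sup>2"
  unfolding node_def using of_nat_div_le_of_nat[of "2 * D ^ 4" "j\<^sup>2", where 'a = real] by simp

lemma node_ge: "1 \<le> j \<Longrightarrow> 2 * real D ^ 4 / (real j)\<^sup>2 - 1 \<le> real (node D j)"
proof -
  have "\<lfloor>real (2 * D ^ 4) / real (j\<^sup>2)\<rfloor> = int (node D j)"
    unfolding node_def by (rule floor_divide_of_nat_eq)
  then have "real (2 * D ^ 4) / real (j\<^sup>2) \<le> 1 + real (node D j)" by linarith
  then show "2 * real D ^ 4 / (real j)\<^sup>2 - 1 \<le> real (node D j)" by simp
qed

lemma node_pos:
  assumes "1 \<le> j" "j \<le> D"
  shows "1 \<le> node D j"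
proof -
  have "j\<^sup>2 \<le> D ^ 4"
    using order_trans[OF power_mono[of j D 2] power_increasing[of 2 4 D]] assms by simp
  then have "j\<^sup>2 \<le> 2 * D ^ 4" by linarith
  then show ?thesis using assms unfolding node_def
    by (metis Suc_leI div_greater_zero_iff One_nat_def less_eq_Suc_le pos2 zero_less_power)
qed

lemma node_le_max: "1 \<le> j \<Longrightarrow> node D j \<le> 2 * D ^ 4"
  unfolding node_def by simp

text \<open>Rounding down costs at most 1 in the difference, while the unrounded difference
  \<open>?g\<close> is at least \<open>2 * D\<close>; the relative loss is therefore at most
  \<open>1 / (2 * D)\<close>.\<close>

lemma node_diff_aux:
  fixes i j D :: nat
  assumes "1 \<le> i" "i < j" "j \<le> D"
  shows "2 * real D ^ 4 * ((real j)\<^sup>2 - (real i)\<^sup>2) / ((real i)\<^sup>2 * (real j)\<^sup>2) * (1 - 1 / (2 * real D))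
      \<le> real (node D i) - real (node D j)"
proof -
  let ?K = "2 * real D ^ 4"
  let ?g = "?K * ((real j)\<^sup>2 - (real i)\<^sup>2) / ((real i)\<^sup>2 * (real j)\<^sup>2)"
  have D: "0 < D" using assms by linarith
  have eq: "?K / (real i)\<^sup>2 - ?K / (real j)\<^sup>2 = ?g"
    using assms by (simp add: field_simps)
  \<comment> \<open>Three of the four factors are bounded by \<open>D\<close> and the remaining
    \<open>i\<close> by \<open>i + j\<close>. Since \<open>j - i \<ge> 1\<close>, the sum may then
    be multiplied by \<open>j - i\<close>.\<close>
  have "(real i)\<^sup>2 * (real j)\<^sup>2 \<le> real D ^ 3 * (real i + real j)"
  proof -
    have "(real i)\<^sup>2 * (real j)\<^sup>2 = real i * real j * real j * real i"
      by (simp add: power2_eq_square)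
    also have "\<dots> \<le> real D * real D * real D * (real i + real j)"
      using assms by (intro mult_mono) auto
    finally show ?thesis by (simp add: power3_eq_cube)
  qed
  also have "\<dots> \<le> real D ^ 3 * ((real i + real j) * (real j - real i))"
  proof -
    have "(real i + real j) * 1 \<le> (real i + real j) * (real j - real i)"
      using assms by (intro mult_left_mono) auto
    then show ?thesis by (intro mult_left_mono) auto
  qed
  finally have "(real i)\<^sup>2 * (real j)\<^sup>2 \<le> real D ^ 3 * ((real j)\<^sup>2 - (real i)\<^sup>2)"
    by (simp add: power2_eq_square algebra_simps)
  then have "1 \<le> real D ^ 3 * ((real j)\<^sup>2 - (real i)\<^sup>2) / ((real i)\<^sup>2 * (real j)\<^sup>2)"
    using assms by (simp add: field_simps)
  also have "\<dots> = ?g * (1 / (2 * real D))"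
    using D by (simp add: power3_eq_cube power4_eq_xxxx)
  finally have "?g * (1 - 1 / (2 * real D)) \<le> ?g - 1"
    by (simp add: right_diff_distrib)
  also have "\<dots> \<le> real (node D i) - real (node D j)"
    using node_ge[of i D] node_le[of j D] assms unfolding eq[symmetric] by linarith
  finally show ?thesis .
qed

lemma node_diff:
  fixes i j D :: nat
  assumes "i \<in> {1..D}" "j \<in> {1..D}" "i \<noteq> j"
  shows "2 * real D ^ 4 * \<bar>(real i)\<^sup>2 - (real j)\<^sup>2\<bar> / ((real i)\<^sup>2 * (real j)\<^sup>2) * (1 - 1 / (2 * real D))
      \<le> \<bar>real (node D i) - real (node D j)\<bar>"
proof (cases "i < j")
  case True
  then have "(real i)\<^sup>2 \<le> (real j)\<^sup>2" by (intro power_mono) auto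
  then show ?thesis using node_diff_aux[of i j D] assms True by auto
next
  case False
  then have "(real j)\<^sup>2 \<le> (real i)\<^sup>2" by (intro power_mono) auto
  then show ?thesis using node_diff_aux[of j i D] assms False by (auto simp: mult.commute)
qed

text \<open>The left side is a factor of the Lagrange coefficient at 0 for the reciprocals of the
  nodes; it exceeds the factor for exact squares by at most the relative rounding loss.\<close>

lemma node_ratio:
  fixes i j D :: nat
  assumes "i \<in> {1..D}" "j \<in> {1..D}" "i \<noteq> j"
  shows "node D i \<noteq> node D j"
    and "real (node D j) / \<bar>real (node D i) - real (node D j)\<bar>
      \<le> (real i)\<^sup>2 / \<bar>(real i)\<^sup>2 - (real j)\<^sup>2\<bar> / (1 - 1 / (2 * real D))"
proof -
  let ?K = "2 * real D ^ 4" and ?c = "1 - 1 / (2 * real D)" and ?s = "\<bar>(real i)\<^sup>2 - (real j)\<^sup>2\<bar>"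
  have D: "0 < D" using assms by auto
  then have c: "0 < ?c" by (simp add: field_simps)
  have s: "0 < ?s" using assms by (simp add: power2_eq_iff_nonneg)
  have pos: "0 < ?K * ?s / ((real i)\<^sup>2 * (real j)\<^sup>2) * ?c"
    using assms D c s by (intro mult_pos_pos divide_pos_pos) auto
  then have *: "0 < \<bar>real (node D i) - real (node D j)\<bar>"
    using node_diff[OF assms] by linarith
  then show "node D i \<noteq> node D j" by auto
  have "real (node D j) / \<bar>real (node D i) - real (node D j)\<bar>
      \<le> (?K / (real j)\<^sup>2) / (?K * ?s / ((real i)\<^sup>2 * (real j)\<^sup>2) * ?c)"
    using assms node_le[of j D] node_diff[OF assms] pos by (intro frac_le) auto
  also have "\<dots> = (real i)\<^sup>2 / ?s / ?c"
    using assms D c s by (simp add: field_simps del: abs_eq_0_iff abs_le_zero_iff)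
  finally show "real (node D j) / \<bar>real (node D i) - real (node D j)\<bar> \<le> (real i)\<^sup>2 / ?s / ?c" .
qed

text \<open>The product for exact squares is at most 2, and by Bernoulli's inequality the
  \<open>D - 1\<close> rounding losses together cost at most another factor 2.\<close>

lemma node_prod_le:
  assumes "j \<in> {1..D}"
  shows "(\<Prod>i\<in>{1..D} - {j}. real (node D j) / \<bar>real (node D i) - real (node D j)\<bar>) \<le> 4"
proof -
  let ?A = "{1..D} - {j}" and ?c = "1 - 1 / (2 * real D)"
  have D: "0 < D" using assms by auto
  then have c: "0 < ?c" "?c \<le> 1" by (auto simp: field_simps)
  have "1/2 = 1 + real D * (- 1 / (2 * real D))" using D by simp
  also have "\<dots> \<le> (1 + (- 1 / (2 * real D))) ^ D"
    by (rule Bernoulli_inequality) (use D in \<open>simp add: field_simps\<close>)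
  also have "\<dots> = ?c ^ D" by simp
  also have "\<dots> \<le> ?c ^ card ?A"
    using c by (intro power_decreasing) (auto simp: card_Diff_singleton_if)
  finally have half: "1/2 \<le> ?c ^ card ?A" .
  have "(\<Prod>i\<in>?A. real (node D j) / \<bar>real (node D i) - real (node D j)\<bar>)
      \<le> (\<Prod>i\<in>?A. (real i)\<^sup>2 / \<bar>(real i)\<^sup>2 - (real j)\<^sup>2\<bar> / ?c)"
    using node_ratio(2)[of _ D j] assms by (intro prod_mono) auto
  also have "\<dots> = (\<Prod>i\<in>?A. (real i)\<^sup>2 / \<bar>(real i)\<^sup>2 - (real j)\<^sup>2\<bar>) / ?c ^ card ?A"
    by (simp only: prod_dividef prod_constant)
  also have "\<dots> \<le> 2 / (1/2)"
    using assms half by (intro frac_le prod_sq_ratio_le) auto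
  finally show ?thesis by simp
qed

text \<open>Lagrange interpolation from the \<open>D\<close> points \<open>1 / node D j\<close>. All
  nodes are at most \<open>2 * D ^ 4\<close>, hence at most \<open>r\<close>, so each value is at
  most \<open>4 * D ^ 4\<close>; each coefficient is at most 4, and there are \<open>D\<close>
  terms.\<close>

lemma poly_bound_at_inverse:
  fixes q :: "complex poly"
  assumes deg: "degree q < D"
    and bnd: "\<And>k. 1 \<le> k \<Longrightarrow> k \<le> r \<Longrightarrow> norm (poly q (1 / of_nat k)) \<le> 2 * real k"
    and r: "2 * D ^ 4 \<le> r"
  shows "norm (poly q (1 / of_nat r)) \<le> 16 * real D ^ 5"
proof -
  define x :: "nat \<Rightarrow> complex" where "x j = 1 / of_nat (node D j)" for j
  have D: "0 < D" using deg by simp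
  have r1: "0 < r" using r D by (cases "r = 0") auto
  have np: "0 < node D j" "node D j \<le> r" if "j \<in> {1..D}" for j
    using node_pos[of j D] node_le_max[of j D] that r by auto
  have inj: "inj_on x {1..D}"
  proof (rule inj_onI)
    fix i j assume "i \<in> {1..D}" "j \<in> {1..D}" "x i = x j"
    then have "node D i = node D j" using np(1)[of i] np(1)[of j] by (simp add: x_def)
    then show "i = j" using node_ratio(1) \<open>i \<in> {1..D}\<close> \<open>j \<in> {1..D}\<close> by blast
  qed
  have "poly q (1 / of_nat r) = (\<Sum>a\<in>x ` {1..D}. poly q a *
      (\<Prod>b\<in>x ` {1..D} - {a}. (1 / of_nat r - b) / (a - b)))"
    by (rule lagrange_eval) (use deg inj in \<open>auto simp: card_image\<close>)
  also have "\<dots> = (\<Sum>j\<in>{1..D}. poly q (x j) *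
      (\<Prod>b\<in>x ` {1..D} - {x j}. (1 / of_nat r - b) / (x j - b)))"
    by (simp add: sum.reindex[OF inj] del: One_nat_def)
  also have "\<dots> = (\<Sum>j\<in>{1..D}. poly q (x j) *
      (\<Prod>i\<in>{1..D} - {j}. (1 / of_nat r - x i) / (x j - x i)))"
  proof (intro sum.cong refl arg_cong2[where f = "(*)"])
    fix j assume j: "j \<in> {1..D}"
    have "x ` {1..D} - {x j} = x ` ({1..D} - {j})"
      using inj j by (simp add: inj_on_image_set_diff)
    moreover have "inj_on x ({1..D} - {j})" by (rule inj_on_subset[OF inj]) auto
    ultimately show "(\<Prod>b\<in>x ` {1..D} - {x j}. (1 / of_nat r - b) / (x j - b))
        = (\<Prod>i\<in>{1..D} - {j}. (1 / of_nat r - x i) / (x j - x i))"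
      by (simp add: prod.reindex)
  qed
  also have "norm \<dots> \<le> (\<Sum>j\<in>{1..D}. (2 * real (2 * D ^ 4)) * 4)"
  proof (rule sum_norm_le)
    fix j assume j: "j \<in> {1..D}"
    have "norm (\<Prod>i\<in>{1..D} - {j}. (1 / of_nat r - x i) / (x j - x i))
        = (\<Prod>i\<in>{1..D} - {j}. norm ((1 / of_nat r - x i) / (x j - x i)))"
      by (simp add: prod_norm)
    also have "\<dots> \<le> (\<Prod>i\<in>{1..D} - {j}. real (node D j) / \<bar>real (node D i) - real (node D j)\<bar>)"
    proof (rule prod_mono, intro conjI)
      fix i assume i: "i \<in> {1..D} - {j}"
      define u v where "u = real (node D i)" and "v = real (node D j)"
      have uv: "0 < u" "0 < v" "u \<noteq> v" "u \<le> real r"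
        using np[of i] np[of j] i j node_ratio(1)[of i D j] by (auto simp: u_def v_def)
      have "(1 / of_nat r - x i) / (x j - x i)
          = complex_of_real ((1 / real r - 1 / u) / (1 / v - 1 / u))"
        by (simp add: x_def u_def v_def)
      then have "norm ((1 / of_nat r - x i) / (x j - x i)) = \<bar>1 / real r - 1 / u\<bar> / \<bar>1 / v - 1 / u\<bar>"
        by (metis norm_of_real abs_divide)
      also have "\<dots> \<le> (1 / u) / \<bar>1 / v - 1 / u\<bar>"
      \<comment> \<open>As \<open>1/r\<close> lies between 0 and every interpolation point, the
        coefficients at \<open>1/r\<close> are no larger than those at 0.\<close>
      proof (rule divide_right_mono)
        have "0 < 1 / real r" "1 / real r \<le> 1 / u" using uv r1 by (auto simp: field_simps)
        then show "\<bar>1 / real r - 1 / u\<bar> \<le> 1 / u" by linarith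
      qed simp
      also have "1 / v - 1 / u = (u - v) / (u * v)" using uv by (simp add: field_simps)
      also have "(1 / u) / \<bar>(u - v) / (u * v)\<bar> = v / \<bar>u - v\<bar>"
        using uv by (simp add: abs_mult field_simps)
      finally show "norm ((1 / of_nat r - x i) / (x j - x i))
          \<le> real (node D j) / \<bar>real (node D i) - real (node D j)\<bar>" by (simp add: u_def v_def)
    qed simp
    also have "\<dots> \<le> 4" by (rule node_prod_le[OF j])
    finally have L: "norm (\<Prod>i\<in>{1..D} - {j}. (1 / of_nat r - x i) / (x j - x i)) \<le> 4" .
    have "norm (poly q (x j)) \<le> 2 * real (node D j)"
      unfolding x_def using np[OF j] by (intro bnd) auto
    also have "\<dots> \<le> 2 * real (2 * D ^ 4)"
      using node_le_max[of j D] j by (simp del: of_nat_mult)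
    finally show "norm (poly q (x j) * (\<Prod>i\<in>{1..D} - {j}. (1 / of_nat r - x i) / (x j - x i)))
        \<le> (2 * real (2 * D ^ 4)) * 4"
      unfolding norm_mult using L by (intro mult_mono) auto
  qed
  also have "\<dots> = 16 * real D ^ 5" using power_Suc[of "real D" 4] by simp
  finally show ?thesis .
qed

text \<open>Write \<open>p(y) - p(0) = y * q(y)\<close>. The quotient has degree below
  \<open>D\<close> and is at most \<open>2 * k\<close> at \<open>1/k\<close>, which is the growth
  allowed in \<open>poly_bound_at_inverse\<close>.\<close>

lemma poly_near_zero:
  fixes p :: "complex poly"
  assumes deg: "degree p \<le> D" and D: "0 < D"
    and bnd: "\<And>k. 1 \<le> k \<Longrightarrow> k \<le> r \<Longrightarrow> norm (poly p (1 / of_nat k)) \<le> 1"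
    and bnd0: "norm (poly p 0) \<le> 1" and r: "2 * D ^ 4 \<le> r"
  shows "norm (poly p (1 / of_nat r) - poly p 0) \<le> 16 * real D ^ 5 / real r"
proof -
  obtain c q where p: "p = pCons c q" by (cases p) auto
  have diff: "poly p y - poly p 0 = y * poly q y" for y by (simp add: p)
  have degq: "degree q < D" using deg D by (cases "q = 0") (auto simp: p degree_pCons_eq)
  have r0: "0 < r" using r D by (cases "r = 0") auto
  have "norm (poly q (1 / of_nat k)) \<le> 2 * real k" if "1 \<le> k" "k \<le> r" for k
  proof -
    have "poly q (1 / of_nat k) = of_nat k * (poly p (1 / of_nat k) - poly p 0)"
      unfolding diff using that by simp
    moreover have "norm (poly p (1 / of_nat k) - poly p 0) \<le> 2"
      using norm_triangle_ineq4[of "poly p (1 / of_nat k)" "poly p 0"] bnd[OF that] bnd0 by linarith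
    then have "real k * norm (poly p (1 / of_nat k) - poly p 0) \<le> real k * 2"
      by (intro mult_left_mono) auto
    ultimately show ?thesis by (simp add: norm_mult mult.commute)
  qed
  from poly_bound_at_inverse[OF degq this r]
  have "norm (poly q (1 / of_nat r)) \<le> 16 * real D ^ 5" .
  then show ?thesis
    unfolding diff using r0 by (simp add: norm_mult norm_divide divide_right_mono)
qed

section \<open>Quantum algorithms\<close>

text \<open>Makes a reversible map out of a prescription on some basis states only; this supplies
  the unitaries in \<open>q_solves_exists\<close>.\<close>

lemma permutes_extending:
  assumes "finite B" "inj_on g I" "inj_on f I" "g ` I \<subseteq> B" "f ` I \<subseteq> B"
  shows "\<exists>p. p permutes B \<and> (\<forall>y\<in>I. p (g y) = f y)"
proof -
  have "inj_on (f \<circ> inv_into I g) (g ` I)"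
    using assms(2,3) by (intro comp_inj_on inj_on_inv_into) (auto simp: image_comp[symmetric])
  moreover have "(f \<circ> inv_into I g) ` (g ` I) \<subseteq> B"
    using assms(2,5) by auto
  ultimately obtain p where "p permutes B" "\<forall>x\<in>g ` I. p x = (f \<circ> inv_into I g) x"
    using inj_on_extend_permutes[OF assms(1,4)] by blast
  then show ?thesis using assms(2) by (intro exI[of _ p]) auto
qed

section \<open>Permutation matrices and preservation of the norm\<close>

definition perm_mat :: "(nat \<Rightarrow> nat) \<Rightarrow> nat \<Rightarrow> nat \<Rightarrow> complex" where
  "perm_mat p a b = (if a = p b then 1 else 0)"

definition basis_vec :: "nat \<Rightarrow> nat \<Rightarrow> complex" where
  "basis_vec k a = (if a = k then 1 else 0)"

lemma unitary_perm_mat: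
  assumes "inj_on p {..<d}" "p ` {..<d} \<subseteq> {..<d}"
  shows "unitary_mat d (perm_mat p)"
  unfolding unitary_mat_def
proof (intro allI impI)
  fix a b assume ab: "a < d" "b < d"
  have "(\<Sum>c<d. cnj (perm_mat p c a) * perm_mat p c b) = (\<Sum>c<d. if c = p a then (if p a = p b then 1 else 0) else 0)"
    by (intro sum.cong) (auto simp: perm_mat_def)
  also have "\<dots> = (if a = b then 1 else 0)"
    using assms ab by (auto simp: inj_on_def)
  finally show "(\<Sum>c<d. cnj (perm_mat p c a) * perm_mat p c b) = (if a = b then 1 else 0)" .
qed

lemma mat_vec_perm_mat:
  assumes "k < d"
  shows "mat_vec d (perm_mat p) (basis_vec k) = basis_vec (p k)"
proof (rule ext)
  fix a
  have "mat_vec d (perm_mat p) (basis_vec k) a = (\<Sum>b<d. if b = k then basis_vec (p k) a else 0)"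
    unfolding mat_vec_def by (intro sum.cong) (auto simp: basis_vec_def perm_mat_def)
  then show "mat_vec d (perm_mat p) (basis_vec k) a = basis_vec (p k) a" using assms by simp
qed

lemma norm_mat_vec:
  assumes "unitary_mat d U"
  shows "(\<Sum>a<d. (cmod (mat_vec d U v a))\<^sup>2) = (\<Sum>a<d. (cmod (v a))\<^sup>2)"
proof -
  have "complex_of_real (\<Sum>a<d. (cmod (mat_vec d U v a))\<^sup>2)
      = (\<Sum>a<d. cnj (\<Sum>b<d. U a b * v b) * (\<Sum>c<d. U a c * v c))"
    by (simp add: complex_norm_square mat_vec_def mult.commute del: of_real_power)
  also have "\<dots> = (\<Sum>a<d. \<Sum>b<d. \<Sum>c<d. cnj (v b) * v c * (cnj (U a b) * U a c))"
    unfolding cnj_sum sum_product by (intro sum.cong refl) (simp add: mult_ac)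
  also have "\<dots> = (\<Sum>b<d. \<Sum>a<d. \<Sum>c<d. cnj (v b) * v c * (cnj (U a b) * U a c))"
    by (rule sum.swap)
  also have "\<dots> = (\<Sum>b<d. \<Sum>c<d. \<Sum>a<d. cnj (v b) * v c * (cnj (U a b) * U a c))"
    by (intro sum.cong refl sum.swap)
  also have "\<dots> = (\<Sum>b<d. \<Sum>c<d. cnj (v b) * v c * (if b = c then 1 else 0))"
    using assms by (intro sum.cong refl) (simp add: sum_distrib_left[symmetric] unitary_mat_def)
  also have "\<dots> = (\<Sum>b<d. cnj (v b) * v b)"
    by (simp add: if_distrib cong: if_cong)
  also have "\<dots> = complex_of_real (\<Sum>a<d. (cmod (v a))\<^sup>2)"
    by (simp add: complex_norm_square mult.commute del: of_real_power)
  finally show ?thesis by (simp only: of_real_eq_iff)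
qed

section \<open>Basis indices, and the query as a permutation of the basis\<close>

lemma bidx_less:
  assumes "i < N" "z < M" "w < W"
  shows "bidx M W i z w < N * M * W"
proof -
  have *: "a * c + b < n * c" if "a < n" "b < c" for a b c n :: nat
  proof -
    have "a * c + b < Suc a * c" using that(2) by simp
    also have "\<dots> \<le> n * c" using that(1) by (intro mult_le_mono1) simp
    finally show ?thesis .
  qed
  show ?thesis unfolding bidx_def using assms by (intro *)
qed

lemma bidx_decode:
  assumes "z < M" "w < W"
  shows "bidx M W i z w div (M * W) = i" "bidx M W i z w div W mod M = z" "bidx M W i z w mod W = w"
proof -
  have 1: "bidx M W i z w div W = i * M + z" "bidx M W i z w mod W = w"
    using assms(2) unfolding bidx_def by auto
  then show "bidx M W i z w div W mod M = z" "bidx M W i z w mod W = w" using assms(1) by auto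
  have "bidx M W i z w div (M * W) = bidx M W i z w div W div M"
    by (metis div_mult2_eq mult.commute)
  then show "bidx M W i z w div (M * W) = i" using 1 assms(1) by simp
qed

lemma bidx_inject:
  assumes "z < M" "w < W" "z' < M" "w' < W"
  shows "bidx M W i z w = bidx M W i' z' w' \<longleftrightarrow> i = i' \<and> z = z' \<and> w = w'"
  using bidx_decode[of z M w W i] bidx_decode[of z' M w' W i'] assms by metis

lemma bidx_split: "b = bidx M W (b div (M * W)) (b div W mod M) (b mod W)"
proof -
  have "b div (M * W) = b div W div M" by (metis div_mult2_eq mult.commute)
  then show ?thesis by (simp add: bidx_def)
qed

definition query_perm :: "nat \<Rightarrow> nat \<Rightarrow> nat list \<Rightarrow> nat \<Rightarrow> nat" where
  "query_perm M W X b = bidx M W (b div (M * W))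
    ((b div W mod M + lookup X (b div (M * W))) mod M) (b mod W)"

lemma query_op_eq: "query_op M W X = perm_mat (query_perm M W X)"
  by (intro ext) (simp add: query_op_def perm_mat_def query_perm_def Let_def)

lemma add_mod_cancel:
  fixes a b x M :: nat
  assumes "a < M" "b < M" "(a + x) mod M = (b + x) mod M"
  shows "a = b"
proof -
  have *: "a = b" if "a \<le> b" "b < M" "(b + x) mod M = (a + x) mod M" for a b :: nat
  proof -
    have "M dvd (b + x) - (a + x)" using that by (subst mod_eq_dvd_iff_nat[symmetric]) auto
    then have "M dvd b - a" by simp
    then show ?thesis using that by (metis dvd_imp_le leD le_less_trans diff_le_self zero_less_diff le_neq_implies_less)
  qed
  show ?thesis using *[of a b] *[of b a] assms by (metis nat_le_linear)
qed

lemma unitary_query_op: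
  assumes "1 \<le> M" "1 \<le> W"
  shows "unitary_mat (N * M * W) (query_op M W X)"
  unfolding query_op_eq
proof (rule unitary_perm_mat)
  show "query_perm M W X ` {..<N * M * W} \<subseteq> {..<N * M * W}"
  proof (rule image_subsetI)
    fix b assume "b \<in> {..<N * M * W}"
    then have "b div (M * W) < N"
      by (metis lessThan_iff less_mult_imp_div_less mult.assoc)
    then show "query_perm M W X b \<in> {..<N * M * W}"
      using assms unfolding query_perm_def by (auto intro!: bidx_less)
  qed
  show "inj_on (query_perm M W X) {..<N * M * W}"
  proof (rule inj_onI)
    fix b b' assume eq: "query_perm M W X b = query_perm M W X b'"
    have e: "b div (M * W) = b' div (M * W)" "b mod W = b' mod W"
      "(b div W mod M + lookup X (b div (M * W))) mod M
        = (b' div W mod M + lookup X (b' div (M * W))) mod M"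
      using eq assms by (auto simp: query_perm_def bidx_inject)
    then have "b div W mod M = b' div W mod M"
      using assms add_mod_cancel[of "b div W mod M" M "b' div W mod M" "lookup X (b div (M * W))"] by simp
    then show "b = b'" using e(1,2) bidx_split[of b M W] bidx_split[of b' M W] by simp
  qed
qed

lemma norm_q_final:
  assumes "1 \<le> N" "1 \<le> M" "1 \<le> W" "unitary_mat (N*M*W) U0" "\<forall>U\<in>set Us. unitary_mat (N*M*W) U"
  shows "(\<Sum>a<N*M*W. (cmod (q_final N M W X U0 Us a))\<^sup>2) = 1"
  using assms(5)
proof (induction Us rule: rev_induct)
  case Nil
  have "(\<Sum>a<N*M*W. (cmod (if a = 0 then 1 else 0))\<^sup>2) = (\<Sum>a<N*M*W. if a = 0 then 1 else 0)"
    by (intro sum.cong) auto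
  then show ?case using assms(1-3) by (simp add: q_final_def norm_mat_vec[OF assms(4)])
next
  case (snoc U Us)
  then show ?case
    using assms(2,3) by (simp add: q_final_def norm_mat_vec unitary_query_op)
qed

lemma q_prob_sum:
  assumes "1 \<le> N" "1 \<le> M" "1 \<le> W" "unitary_mat (N*M*W) U0" "\<forall>U\<in>set Us. unitary_mat (N*M*W) U"
  shows "q_prob N M W X U0 Us out True + q_prob N M W X U0 Us out False = 1"
proof -
  have "{..<N*M*W} = {a. a < N*M*W \<and> out a = True} \<union> {a. a < N*M*W \<and> out a = False}" by auto
  then show ?thesis
    unfolding norm_q_final[OF assms, of X, symmetric] q_prob_def
    by (simp only:) (rule sum.union_disjoint[symmetric]; auto)
qed

lemma q_prob_nonneg: "0 \<le> q_prob N M W X U0 Us out b"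
  unfolding q_prob_def by (intro sum_nonneg) auto

text \<open>Without this the \<open>LEAST\<close> in \<open>Q_cplx\<close> could be an unspecified number. The algorithm
  collects the entries read so far, encoded by \<open>enc\<close>, in the workspace register.\<close>

lemma q_solves_exists:
  assumes "1 \<le> N" "1 \<le> M"
  shows "\<exists>T. q_solves N M f T"
proof -
  define Ls where "Ls = {p. set p \<subseteq> {..<M} \<and> length p \<le> N}"
  define W where "W = card Ls"
  have fin: "finite Ls" unfolding Ls_def by (rule finite_lists_length_le) simp
  have "[] \<in> Ls" by (simp add: Ls_def)
  then have W: "1 \<le> W" unfolding W_def using fin by (metis One_nat_def Suc_leI card_gt_0_iff empty_iff)
  obtain enc where enc: "bij_betw enc Ls {..<W}"
    using ex_bij_betw_finite_nat[OF fin] unfolding W_def lessThan_atLeast0 by blast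
  have enc_less: "enc p < W" if "p \<in> Ls" for p using enc that by (auto simp: bij_betw_def)
  have enc_inj: "enc p = enc q \<longleftrightarrow> p = q" if "p \<in> Ls" "q \<in> Ls" for p q
    using enc that by (auto simp: bij_betw_def inj_on_def)
  let ?d = "N * M * W"
  have "\<exists>p. p permutes {..<?d} \<and> (\<forall>y\<in>{()}. p ((\<lambda>_. 0) y) = (\<lambda>_. bidx M W 0 0 (enc [])) y)"
    by (rule permutes_extending) (use assms W \<open>[] \<in> Ls\<close> in \<open>auto intro!: bidx_less enc_less\<close>)
  then obtain p0 where p0: "p0 permutes {..<?d}" "p0 0 = bidx M W 0 0 (enc [])" by auto
  \<comment> \<open>Step \<open>t\<close> moves the value just read to the end of the stored list,
    clears the value register and advances the address. The map is injective because
    \<open>l @ [x]\<close> still contains \<open>x\<close>. The address wraps to 0 after the last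
    position, so that it stays below \<open>N\<close>.\<close>
  have "\<exists>p. p permutes {..<?d} \<and> (\<forall>x l. x < M \<longrightarrow> l \<in> Ls \<longrightarrow> length l = t \<longrightarrow>
        p (bidx M W t x (enc l)) = bidx M W (Suc t mod N) 0 (enc (l @ [x])))" if t: "t < N" for t
  proof -
    let ?I = "{..<M} \<times> {l \<in> Ls. length l = t}"
    let ?g = "\<lambda>(x, l). bidx M W t x (enc l)" and ?f = "\<lambda>(x, l). bidx M W (Suc t mod N) 0 (enc (l @ [x]))"
    have snoc: "snd y @ [fst y] \<in> Ls" if "y \<in> ?I" for y using that t by (auto simp: Ls_def)
    have "\<exists>p. p permutes {..<?d} \<and> (\<forall>y\<in>?I. p (?g y) = ?f y)"
    proof (rule permutes_extending)
      show "inj_on ?g ?I"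
      proof (rule inj_onI)
        fix y y' assume y: "y \<in> ?I" "y' \<in> ?I" "?g y = ?g y'"
        then have "fst y = fst y' \<and> enc (snd y) = enc (snd y')"
          by (simp add: case_prod_unfold bidx_inject enc_less mem_Times_iff)
        then show "y = y'" using y(1,2) enc_inj[of "snd y" "snd y'"]
          by (simp add: mem_Times_iff prod_eq_iff)
      qed
      show "inj_on ?f ?I"
      proof (rule inj_onI)
        fix y y' assume y: "y \<in> ?I" "y' \<in> ?I" "?f y = ?f y'"
        then have "enc (snd y @ [fst y]) = enc (snd y' @ [fst y'])"
          using assms snoc by (simp add: case_prod_unfold bidx_inject enc_less)
        then show "y = y'" using snoc[OF y(1)] snoc[OF y(2)] by (simp add: enc_inj prod_eq_iff)
      qed
      show "?g ` ?I \<subseteq> {..<?d}"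
        using t by (auto intro!: bidx_less enc_less)
      show "?f ` ?I \<subseteq> {..<?d}"
      proof (rule image_subsetI)
        fix y assume "y \<in> ?I"
        then show "?f y \<in> {..<?d}"
          using assms bidx_less[of "Suc t mod N" N 0 M] enc_less snoc by (simp add: case_prod_unfold)
      qed
    qed simp
    then show ?thesis by auto
  qed
  then have "\<forall>t. \<exists>p. t < N \<longrightarrow> p permutes {..<?d} \<and> (\<forall>x l. x < M \<longrightarrow> l \<in> Ls \<longrightarrow> length l = t \<longrightarrow>
        p (bidx M W t x (enc l)) = bidx M W (Suc t mod N) 0 (enc (l @ [x])))" by blast
  from choice[OF this] obtain p where p: "\<And>t. t < N \<Longrightarrow> p t permutes {..<?d}"
    "\<And>t x l. t < N \<Longrightarrow> x < M \<Longrightarrow> l \<in> Ls \<Longrightarrow> length l = t \<Longrightarrow>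
      p t (bidx M W t x (enc l)) = bidx M W (Suc t mod N) 0 (enc (l @ [x]))"
    by blast
  let ?Us = "\<lambda>t. map (\<lambda>t. perm_mat (p t)) [0..<t]"
  have final: "q_final N M W X (perm_mat p0) (?Us t) = basis_vec (bidx M W (t mod N) 0 (enc (take t X)))"
    if X: "X \<in> inputs N M" and "t \<le> N" for X t
    using that(2)
  proof (induction t)
    case 0
    have "(\<lambda>a. if a = 0 then 1 else 0) = basis_vec 0" by (auto simp: basis_vec_def)
    then show ?case using assms W by (simp add: q_final_def mat_vec_perm_mat p0)
  next
    case (Suc t)
    then have t: "t < N" "t < length X" using X by (auto simp: inputs_def)
    have "X ! t \<in> {..<M}" using X t(2) nth_mem[of t X] unfolding inputs_def by blast
    then have Xt: "X ! t < M" by simp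
    have Ls: "take t X \<in> Ls" using X t by (auto simp: Ls_def inputs_def dest: in_set_takeD)
    have lt: "bidx M W t y (enc (take t X)) < ?d" if "y < M" for y
      using t that Ls by (intro bidx_less enc_less)
    have "query_perm M W X (bidx M W t 0 (enc (take t X))) = bidx M W t (X ! t) (enc (take t X))"
      using assms Xt t enc_less[OF Ls] bidx_decode[of 0 M "enc (take t X)" W t]
      by (simp add: query_perm_def lookup_def)
    moreover have "p t (bidx M W t (X ! t) (enc (take t X)))
        = bidx M W (Suc t mod N) 0 (enc (take (Suc t) X))"
      using p(2)[of t "X ! t" "take t X"] t Xt Ls by (simp add: take_Suc_conv_app_nth)
    ultimately show ?case
      using Suc t Xt lt[of 0] lt[of "X ! t"] assms
      by (simp add: q_final_def query_op_eq mat_vec_perm_mat)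
  qed
  define out where "out b = the (f (inv_into Ls enc (b mod W)))" for b
  have "q_prob N M W X (perm_mat p0) (?Us N) out (the (f X)) \<ge> 2/3" if "X \<in> domset N M f" for X
  proof -
    have X: "X \<in> inputs N M" using that by (simp add: domset_def)
    then have XL: "X \<in> Ls" "length X = N" by (auto simp: Ls_def inputs_def)
    let ?k = "bidx M W 0 0 (enc X)"
    have k: "?k < ?d" using assms XL by (intro bidx_less enc_less) auto
    have "?k mod W = enc X" using assms enc_less[OF XL(1)] by (intro bidx_decode(3)) auto
    then have "out ?k = the (f X)"
      using enc XL(1) by (simp add: out_def bij_betw_def)
    then have mem: "?k \<in> {a. a < ?d \<and> out a = the (f X)}" using k by simp
    have "q_prob N M W X (perm_mat p0) (?Us N) out (the (f X))
        = (\<Sum>a\<in>{a. a < ?d \<and> out a = the (f X)}. if a = ?k then 1 else 0)"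
      unfolding q_prob_def final[OF X order_refl] using XL(2)
      by (intro sum.cong) (auto simp: basis_vec_def)
    also have "\<dots> = 1" using mem by (subst sum.delta) auto
    finally show ?thesis by simp
  qed
  moreover have "unitary_mat ?d (perm_mat q)" if "q permutes {..<?d}" for q
    using that permutes_image[OF that] by (intro unitary_perm_mat permutes_inj_on) auto
  ultimately have "q_solves N M f N"
    unfolding q_solves_def
    by (intro exI[of _ W] exI[of _ "perm_mat p0"] exI[of _ "?Us N"] exI[of _ out])
      (use W p0(1) p(1) in auto)
  then show ?thesis by blast
qed

section \<open>Classical simulation\<close>

primrec read_tree :: "nat list \<Rightarrow> (nat list \<Rightarrow> bool) \<Rightarrow> dtree" where
  "read_tree [] k = Leaf (k [])"
| "read_tree (i # is) k = Query i (\<lambda>v. read_tree is (\<lambda>vs. k (v # vs)))"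

lemma dt_eval_read_tree: "dt_eval (read_tree is k) X = k (map (lookup X) is)"
  by (induction "is" arbitrary: k) auto

lemma dt_cost_read_tree: "dt_cost (read_tree is k) X = length is"
  by (induction "is" arbitrary: k) auto

lemma R_cplx_le:
  assumes "rand_correct N M f A" "\<And>T X. T \<in> set_pmf A \<Longrightarrow> dt_cost T X = n"
  shows "R_cplx N M f \<le> ennreal (real n)"
proof -
  have "(\<integral>\<^sup>+ T. ennreal (real (dt_cost T X)) \<partial>(measure_pmf A)) = ennreal (real n)" for X
  proof -
    have "(\<integral>\<^sup>+ T. ennreal (real (dt_cost T X)) \<partial>(measure_pmf A)) = (\<integral>\<^sup>+ T. ennreal (real n) \<partial>(measure_pmf A))"
      by (rule nn_integral_cong_AE) (simp add: AE_measure_pmf_iff assms(2))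
    then show ?thesis by simp
  qed
  then have "rand_cost N M f A \<le> ennreal (real n)"
    unfolding rand_cost_def by (intro SUP_least) simp
  moreover have "R_cplx N M f \<le> rand_cost N M f A"
    unfolding R_cplx_def using assms(1) by (intro INF_lower) simp
  ultimately show ?thesis by (rule order_trans[rotated])
qed

lemma R_cplx_le_length: "R_cplx N M f \<le> ennreal (real N)"
proof (rule R_cplx_le)
  let ?t = "read_tree [0..<N] (\<lambda>vs. the (f vs))"
  have "dt_eval ?t X = the (f X)" if "X \<in> domset N M f" for X
  proof -
    have "map (lookup X) [0..<N] = X"
      using that by (intro nth_equalityI) (auto simp: domset_def inputs_def lookup_def)
    then show ?thesis by (simp add: dt_eval_read_tree)
  qed
  then show "rand_correct N M f (return_pmf ?t)"
    by (simp add: rand_correct_def)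
qed (simp add: dt_cost_read_tree)

text \<open>Without queries the output distribution ignores the input. Two values of
  \<open>f\<close> on its domain would both need probability at least 2/3, so \<open>f\<close> is
  constant there and a leaf suffices.\<close>

lemma R_cplx_zero:
  assumes "1 \<le> N" "1 \<le> M" "q_solves N M f 0"
  shows "R_cplx N M f = 0"
proof -
  obtain W U0 out where W: "1 \<le> W" "unitary_mat (N*M*W) U0"
    and ok: "\<And>X. X \<in> domset N M f \<Longrightarrow> q_prob N M W X U0 [] out (the (f X)) \<ge> 2/3"
    using assms(3) unfolding q_solves_def by auto
  have indep: "q_prob N M W X U0 [] out b = q_prob N M W Y U0 [] out b" for X Y b
    by (simp add: q_prob_def q_final_def)
  have "the (f X) = the (f Y)" if "X \<in> domset N M f" "Y \<in> domset N M f" for X Y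
  proof (rule ccontr)
    assume "the (f X) \<noteq> the (f Y)"
    then have "q_prob N M W X U0 [] out (the (f X)) + q_prob N M W X U0 [] out (the (f Y))
        = q_prob N M W X U0 [] out True + q_prob N M W X U0 [] out False"
      by (cases "the (f X)"; cases "the (f Y)") auto
    also have "\<dots> = 1" using assms(1,2) W by (intro q_prob_sum) auto
    finally show False using ok[OF that(1)] ok[OF that(2)] indep[of X "the (f Y)" Y] by simp
  qed
  then obtain b where "\<And>X. X \<in> domset N M f \<Longrightarrow> the (f X) = b" by metis
  then have "rand_correct N M f (return_pmf (Leaf b))" by (simp add: rand_correct_def)
  then have "R_cplx N M f \<le> ennreal (real 0)" by (rule R_cplx_le) simp
  then show ?thesis by simp
qed

section \<open>The classical small-range algorithm\<close>

lemma perm_invariant_shuffle: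
  assumes "perm_invariant N M f" "X \<in> domset N M f" "\<pi> permutes {..<N}"
  shows "map (lookup X \<circ> \<pi>) [0..<N] \<in> domset N M f" "f (map (lookup X \<circ> \<pi>) [0..<N]) = f X"
proof -
  have X: "X \<in> inputs N M" "length X = N" "set X \<subseteq> {..<M}"
    using assms(2) by (auto simp: domset_def inputs_def)
  have \<pi>: "\<pi> i < N" if "i < N" for i using permutes_in_image[OF assms(3), of i] that by simp
  have eq: "map (lookup X \<circ> \<pi>) [0..<N] = map (\<lambda>i. id (X ! \<pi> i)) [0..<N]"
    using X(2) \<pi> by (auto simp: lookup_def)
  show f: "f (map (lookup X \<circ> \<pi>) [0..<N]) = f X"
    using assms(1,3) X(1) permutes_id[of "{..<M}"] unfolding eq perm_invariant_def by metis
  have "map (lookup X \<circ> \<pi>) [0..<N] \<in> inputs N M"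
    unfolding eq using X \<pi> nth_mem by (fastforce simp: inputs_def)
  then show "map (lookup X \<circ> \<pi>) [0..<N] \<in> domset N M f"
    using f assms(2) by (simp add: domset_def)
qed

text \<open>Both expectations are values of one polynomial of degree at most \<open>D\<close>, at
  \<open>1/r\<close> and at 0. As averages of \<open>B\<close> they are bounded by 1, also for every
  smaller range, so \<open>poly_near_zero\<close> applies.\<close>

lemma small_range_close:
  fixes B :: "(nat \<Rightarrow> nat) \<Rightarrow> real"
  assumes B: "junta_sum N D (\<lambda>z. complex_of_real (B z))" "\<And>z. 0 \<le> B z \<and> B z \<le> 1"
    and D: "0 < D" and r: "2 * D ^ 4 \<le> r" "r \<le> N"
  shows "\<bar>measure_pmf.expectation (small_range N r) (\<lambda>(h, \<pi>). B (x \<circ> \<pi> \<circ> h))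
      - measure_pmf.expectation (perms N) (\<lambda>\<pi>. B (x \<circ> \<pi>))\<bar> \<le> 16 * real D ^ 5 / real r"
proof -
  let ?E = "\<lambda>k. measure_pmf.expectation (small_range N k) (\<lambda>(h, \<pi>). B (x \<circ> \<pi> \<circ> h))"
  let ?Ep = "measure_pmf.expectation (perms N) (\<lambda>\<pi>. B (x \<circ> \<pi>))"
  obtain p where p: "degree p \<le> D"
    "poly p 0 = measure_pmf.expectation (perms N) (\<lambda>\<pi>. complex_of_real (B (x \<circ> \<pi>)))"
    "\<And>k. 1 \<le> k \<Longrightarrow> k \<le> N \<Longrightarrow> measure_pmf.expectation (small_range N k)
      (\<lambda>(h, \<pi>). complex_of_real (B (x \<circ> \<pi> \<circ> h))) = poly p (1 / of_nat k)"
    using expectation_small_range_poly[OF B(1), of x] by blast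
  have p0: "poly p 0 = complex_of_real ?Ep" by (simp add: p(2))
  have pk: "poly p (1 / of_nat k) = complex_of_real (?E k)" if "1 \<le> k" "k \<le> N" for k
    using p(3)[OF that] by (simp add: case_prod_unfold)
  have bnd: "\<bar>measure_pmf.expectation q g\<bar> \<le> 1" if "\<And>y. 0 \<le> g y \<and> g y \<le> (1::real)" for q :: "'b pmf" and g
  proof -
    have "integrable (measure_pmf q) g"
      by (rule measure_pmf.integrable_const_bound[where B = 1]) (use that in auto)
    then have "measure_pmf.expectation q g \<le> 1"
      by (rule measure_pmf.integral_le_const) (use that in auto)
    moreover have "0 \<le> measure_pmf.expectation q g" by (rule Bochner_Integration.integral_nonneg) (use that in auto)
    ultimately show ?thesis by simp
  qed
  have "norm (poly p (1 / of_nat r) - poly p 0) \<le> 16 * real D ^ 5 / real r"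
  proof (rule poly_near_zero[OF p(1) D _ _ r(1)])
    fix k assume k: "1 \<le> k" "k \<le> r"
    then show "norm (poly p (1 / of_nat k)) \<le> 1"
      using r(2) bnd[of "\<lambda>(h, \<pi>). B (x \<circ> \<pi> \<circ> h)"] B(2) by (simp add: pk norm_of_real case_prod_unfold)
  next
    show "norm (poly p 0) \<le> 1" unfolding p0 norm_of_real by (rule bnd) (rule B(2))
  qed
  moreover have "1 \<le> r" using r(1) D by (cases "r = 0") auto
  ultimately show ?thesis
    using r(2) by (simp add: pk p0 norm_of_real flip: of_real_diff)
qed

text \<open>The factor 54 is \<open>2 * 3 ^ 3\<close>: the degree \<open>2 * T\<close> of the
  acceptance probability, tripled by each of three amplifications. The factor 192 is
  \<open>16 * 12\<close>, making the small-range error 1/12. If \<open>r\<close> exceeds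
  \<open>N\<close>, reading the whole input is cheap enough.\<close>

lemma R_cplx_le_of_q_solves:
  assumes N: "1 \<le> N" and M: "1 \<le> M" and inv: "perm_invariant N M f"
    and sol: "q_solves N M f T" and T: "0 < T"
    and D: "D = 54 * T" and r: "r = 192 * D ^ 5"
  shows "R_cplx N M f \<le> ennreal (real r)"
proof (cases "r \<le> N")
  case False
  have "R_cplx N M f \<le> ennreal (real N)" by (rule R_cplx_le_length)
  also have "\<dots> \<le> ennreal (real r)" using False by (intro ennreal_leI) simp
  finally show ?thesis .
next
  case True
  obtain W U0 Us out where W: "1 \<le> W" and Us: "length Us = T" and U: "unitary_mat (N*M*W) U0"
      "\<forall>U\<in>set Us. unitary_mat (N*M*W) U"
    and ok: "\<And>X. X \<in> domset N M f \<Longrightarrow> q_prob N M W X U0 Us out (the (f X)) \<ge> 2/3"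
    using sol unfolding q_solves_def by blast
  define P where "P z = q_prob N M W (map z [0..<N]) U0 Us out True" for z
  define B where "B z = boost (boost (boost (P z)))" for z
  have PF: "q_prob N M W (map z [0..<N]) U0 Us out False = 1 - P z" for z
    using q_prob_sum[OF N M W U, of "map z [0..<N]" out] by (simp add: P_def)
  have P01: "0 \<le> P z" "P z \<le> 1" for z
    using PF[of z] q_prob_nonneg[of N M W "map z [0..<N]" U0 Us out] unfolding P_def by smt+
  have B01: "0 \<le> B z \<and> B z \<le> 1" for z using boost3_bounds(1,2)[OF P01] by (simp add: B_def)
  have "junta_sum N (2 * T) (\<lambda>z. complex_of_real (P z))"
    unfolding P_def Us[symmetric] by (rule junta_sum_q_prob)
  from junta_sum_boost[OF junta_sum_boost[OF junta_sum_boost[OF this]]]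
  have Bj: "junta_sum N D (\<lambda>z. complex_of_real (B z))" by (simp add: B_def boost_of_real D)
  have D0: "0 < D" using T D by simp
  have r0: "0 < r" using D0 r by simp
  have rD: "2 * D ^ 4 \<le> r"
  proof -
    have "D ^ 4 \<le> D ^ 5" using D0 by (intro power_increasing) auto
    then show ?thesis unfolding r by linarith
  qed
  have gap: "16 * real D ^ 5 / real r = 1/12" using D0 by (simp add: r)
  \<comment> \<open>For a drawn pair \<open>(h, \<pi>)\<close>, the positions
    \<open>\<pi> 0, ..., \<pi> (r - 1)\<close> are read. Since \<open>h\<close> takes values below
    \<open>r\<close>, they determine the composed input, on which the amplified acceptance
    probability is computed exactly and compared with 1/2.\<close>
  define tree where "tree = (\<lambda>(h, \<pi>). read_tree (map \<pi> [0..<r]) (\<lambda>vs. 1/2 \<le> B (\<lambda>i. vs ! h i)))"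
  have tree_eval: "dt_eval (tree y) X = (1/2 \<le> B (lookup X \<circ> snd y \<circ> fst y))"
    if y: "y \<in> set_pmf (small_range N r)" for y X
  proof -
    have "fst y i < r" for i using small_range_bound[OF r0, of "fst y" "snd y" N i] y by simp
    then have "(\<lambda>i. map (lookup X) (map (snd y) [0..<r]) ! fst y i) = lookup X \<circ> snd y \<circ> fst y"
      by (auto simp: fun_eq_iff)
    then show ?thesis by (simp add: tree_def case_prod_unfold dt_eval_read_tree del: map_map)
  qed
  have int: "integrable (measure_pmf q) g" if "finite (set_pmf q)" for q :: "'b pmf" and g :: "'b \<Rightarrow> real"
    using that by (rule integrable_measure_pmf_finite)
  show ?thesis
  proof (rule R_cplx_le)
    show "rand_correct N M f (map_pmf tree (small_range N r))"
      unfolding rand_correct_def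
    proof
      fix X assume X: "X \<in> domset N M f"
      define x where "x = lookup X"
      define G where "G = (\<lambda>y :: (nat \<Rightarrow> nat) \<times> (nat \<Rightarrow> nat). B (x \<circ> snd y \<circ> fst y))"
      let ?S = "small_range N r" and ?good = "{y. dt_eval (tree y) X = the (f X)}"
      have fin: "finite (set_pmf ?S)" by (rule finite_set_small_range[OF r0])
      have finp: "finite (set_pmf (perms N))" using permutes_lessThan_fin by simp
      have close: "\<bar>measure_pmf.expectation ?S G - measure_pmf.expectation (perms N) (\<lambda>\<pi>. B (x \<circ> \<pi>))\<bar> \<le> 1/12"
        using small_range_close[OF Bj B01 D0 rD True, of x] unfolding gap
        by (simp add: G_def case_prod_unfold)
      have Pperm: "q_prob N M W (map (x \<circ> \<pi>) [0..<N]) U0 Us out (the (f X)) \<ge> 2/3"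
        if "\<pi> permutes {..<N}" for \<pi>
        using ok[OF perm_invariant_shuffle(1)[OF inv X that]] perm_invariant_shuffle(2)[OF inv X that]
        by (simp add: x_def)
      have prob: "measure_pmf.prob (map_pmf tree ?S) {T. dt_eval T X = the (f X)}
          = measure_pmf.expectation ?S (indicator ?good)"
        by (simp add: vimage_def)
      show "2/3 \<le> measure_pmf.prob (map_pmf tree ?S) {T. dt_eval T X = the (f X)}"
      proof (cases "the (f X)")
        case fX: True
        have "11/12 \<le> measure_pmf.expectation (perms N) (\<lambda>\<pi>. B (x \<circ> \<pi>))"
        proof (rule measure_pmf.integral_ge_const[OF int[OF finp]])
          show "AE \<pi> in measure_pmf (perms N). 11/12 \<le> B (x \<circ> \<pi>)"
            unfolding AE_measure_pmf_iff B_def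
          proof
            fix \<pi> assume "\<pi> \<in> set_pmf (perms N)"
            then have "2/3 \<le> P (x \<circ> \<pi>)" using Pperm[of \<pi>] fX by (simp add: P_def)
            then show "11/12 \<le> boost (boost (boost (P (x \<circ> \<pi>))))" by (rule boost3_bounds(3)[OF P01])
          qed
        qed
        then have "5/6 \<le> measure_pmf.expectation ?S G" using close by linarith
        \<comment> \<open>A Markov-type bound: \<open>2 * G - 1\<close> never exceeds the indicator
          of \<open>G \<ge> 1/2\<close>, and \<open>2 * 5/6 - 1 = 2/3\<close>. The rejecting case
          uses \<open>1 - 2 * G\<close> in the same way.\<close>
        then have "2/3 \<le> measure_pmf.expectation ?S (\<lambda>y. 2 * G y - 1)"
          by (simp add: int[OF fin])
        also have "\<dots> \<le> measure_pmf.expectation ?S (indicator ?good)"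
        proof (rule integral_mono_AE[OF int[OF fin] int[OF fin]])
          show "AE y in measure_pmf ?S. 2 * G y - 1 \<le> indicator ?good y"
            unfolding AE_measure_pmf_iff using B01 fX
            by (auto simp: indicator_def G_def tree_eval x_def)
        qed
        finally show ?thesis unfolding prob .
      next
        case fX: False
        have "measure_pmf.expectation (perms N) (\<lambda>\<pi>. B (x \<circ> \<pi>)) \<le> 1/12"
        proof (rule measure_pmf.integral_le_const[OF int[OF finp]])
          show "AE \<pi> in measure_pmf (perms N). B (x \<circ> \<pi>) \<le> 1/12"
            unfolding AE_measure_pmf_iff B_def
          proof
            fix \<pi> assume "\<pi> \<in> set_pmf (perms N)"
            then have "P (x \<circ> \<pi>) \<le> 1/3" using Pperm[of \<pi>] fX by (simp add: PF)
            then show "boost (boost (boost (P (x \<circ> \<pi>)))) \<le> 1/12" by (rule boost3_bounds(4)[OF P01])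
          qed
        qed
        then have "measure_pmf.expectation ?S G \<le> 1/6" using close by linarith
        then have "2/3 \<le> measure_pmf.expectation ?S (\<lambda>y. 1 - 2 * G y)"
          by (simp add: int[OF fin])
        also have "\<dots> \<le> measure_pmf.expectation ?S (indicator ?good)"
        proof (rule integral_mono_AE[OF int[OF fin] int[OF fin]])
          show "AE y in measure_pmf ?S. 1 - 2 * G y \<le> indicator ?good y"
            unfolding AE_measure_pmf_iff using B01 fX
            by (auto simp: indicator_def G_def tree_eval x_def)
        qed
        finally show ?thesis unfolding prob .
      qed
    qed
  qed (auto simp: tree_def dt_cost_read_tree)
qed

theorem theorem5:
  shows "\<exists>(k::nat) (C::real). \<forall>(N::nat) (M::nat) (f :: nat list \<Rightarrow> bool option).
     N \<ge> 1 \<longrightarrow> M \<ge> 1 \<longrightarrow> perm_invariant N M f \<longrightarrow>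
     R_cplx N M f \<le> ennreal (C * real (Q_cplx N M f) ^ 9 *
                               (max 1 (ln (real (Q_cplx N M f)))) ^ k)"
proof (rule exI[of _ "0::nat"], rule exI[of _ "192 * 54 ^ 5"], intro allI impI)
  fix N M :: nat and f
  assume N: "N \<ge> 1" and M: "M \<ge> 1" and inv: "perm_invariant N M f"
  define T where "T = Q_cplx N M f"
  have sol: "q_solves N M f T"
    unfolding T_def Q_cplx_def using q_solves_exists[OF N M] by (rule LeastI_ex)
  show "R_cplx N M f \<le> ennreal (192 * 54 ^ 5 * real (Q_cplx N M f) ^ 9 *
      (max 1 (ln (real (Q_cplx N M f)))) ^ 0)"
  \<comment> \<open>For \<open>T = 0\<close> the right side vanishes, so the randomized complexity
    must be exactly 0.\<close>
  proof (cases "T = 0")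
    case True
    then show ?thesis using R_cplx_zero[OF N M] sol by simp
  next
    case False
    have "R_cplx N M f \<le> ennreal (real (192 * (54 * T) ^ 5))"
      using R_cplx_le_of_q_solves[OF N M inv sol _ refl refl] False by blast
    also have "\<dots> \<le> ennreal (192 * 54 ^ 5 * real T ^ 9)"
    proof (rule ennreal_leI)
      \<comment> \<open>The simulation costs \<open>192 * (54 * T) ^ 5\<close> queries; since
        \<open>T \<ge> 1\<close> this lies below the ninth power with the same constant.\<close>
      have "real T ^ 5 \<le> real T ^ 9" using False by (intro power_increasing) auto
      then show "real (192 * (54 * T) ^ 5) \<le> 192 * 54 ^ 5 * real T ^ 9"
        by (simp add: power_mult_distrib)
    qed
    finally show ?thesis by (simp add: T_def)
  qed
qed

end
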